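(* Let $n\in\mathbb{N}$ and let $S$ be a finite-dimensional subspace of $C(\mathbb{S}^{n-1})$ that is $\mathcal{O}_n$-invariant, and suppose that (the restriction to $C(\mathbb{S}^{n-1})$ of) the orthogonal projection $\pi_S$ is the unique $\mathcal{O}_n$-equivariant projection from $C(\mathbb{S}^{n-1})$ onto $S$. Then $$\boldsymbol{\lambda}(S) = \big\|\pi_S\colon C(\mathbb{S}^{n-1})\to S\big\| = \int_{\mathbb{S}^{n-1}} |\mathbf{k}_S(e_1,y)|\,d\sigma_n(y).$$
   Context: $\mathbb{S}^{n-1}$ is the Euclidean unit sphere of $\mathbb{R}^n$, $\sigma_n$ its normalized (rotation-invariant, probability) surface measure, $\mathcal{O}_n$ the orthogonal group of $\mathbb{R}^n$, $e_1=(1,0,\dots,0)$. $C(\mathbb{S}^{n-1})$ is the complex Banach space of continuous complex-valued functions with the supremum norm; $S$ carries the supremum norm as well. $S$ is $\mathcal{O}_n$-invariant if $f\circ A\in S$ for all $f\in S$, $A\in\mathcal{O}_n$. A projection onto $S$ is a bounded linear map $\mathbf{Q}\colon C(\mathbb{S}^{n-1})\to S$ with $\mathbf{Q}|_S=\mathrm{id}_S$; it is $\mathcal{O}_n$-equivariant if $\mathbf{Q}(f\circ A)=\mathbf{Q}(f)\circ A$ for all $f\in C(\mathbb{S}^{n-1})$ and $A\in\mathcal{O}_n$. $\pi_S$ is the orthogonal projection from $L_2(\sigma_n)$ onto $S$. The reproducing kernel of $S$ is $\mathbf{k}_S\colon\mathbb{S}^{n-1}\times\mathbb{S}^{n-1}\to\mathbb{C}$,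 $\mathbf{k}_S(x,y)=\sum_{j=1}^{\dim S}\overline{f_j(x)}f_j(y)$, where $(f_j)$ is any $L_2(\sigma_n)$-orthonormal basis of $S$ (it does not depend on the basis); equivalently $(\pi_Sf)(x)=\int f(y)\overline{\mathbf{k}_S(x,y)}\,d\sigma_n(y)$ for all $f\in L_2(\sigma_n)$ and $x\in \mathbb{S}^{n-1}$. For a subspace $X$ of a Banach space $Y$, $\boldsymbol{\lambda}(X,Y)=\inf\{\|P\|: P\in\mathcal{L}(Y,X),\ P|_X=\mathrm{id}_X\}$ (with $\inf\varnothing=\infty$). The (absolute) projection constant of $X$ is $\boldsymbol{\lambda}(X)=\sup\boldsymbol{\lambda}(I(X),Y)$, the supremum over all complex Banach spaces $Y$ and all linear isometric embeddings $I\colon X\to Y$. *)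

theory Defs
  imports "HOL-Probability.Probability" "HOL-Library.Function_Algebras"
begin

section \<open>Complex normed spaces with explicit carrier\<close>

text \<open>
  The absolute projection constant is a supremum over all complex Banach spaces, so these have to
  be objects of the logic rather than types.  Functions defined on such a space are HOL functions
  on the underlying type; only their values on the carrier \<open>pts\<close> are relevant.
\<close>

record 'a cnspace =
  pts :: "'a set"
  vadd :: "'a \<Rightarrow> 'a \<Rightarrow> 'a"
  vzero :: 'a
  vscale :: "complex \<Rightarrow> 'a \<Rightarrow> 'a"
  vnorm :: "'a \<Rightarrow> real"

definition vdiff :: "'a cnspace \<Rightarrow> 'a \<Rightarrow> 'a \<Rightarrow> 'a" where
  "vdiff X x y = vadd X x (vscale X (- 1) y)"

locale complex_normed_space =
  fixes X :: "'a cnspace"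
  assumes zero_in: "vzero X \<in> pts X"
    and add_in: "\<lbrakk>x \<in> pts X; y \<in> pts X\<rbrakk> \<Longrightarrow> vadd X x y \<in> pts X"
    and scale_in: "x \<in> pts X \<Longrightarrow> vscale X a x \<in> pts X"
    and add_assoc: "\<lbrakk>x \<in> pts X; y \<in> pts X; z \<in> pts X\<rbrakk> \<Longrightarrow>
          vadd X (vadd X x y) z = vadd X x (vadd X y z)"
    and add_commute: "\<lbrakk>x \<in> pts X; y \<in> pts X\<rbrakk> \<Longrightarrow> vadd X x y = vadd X y x"
    and zero_add: "x \<in> pts X \<Longrightarrow> vadd X (vzero X) x = x"
    and diff_self: "x \<in> pts X \<Longrightarrow> vdiff X x x = vzero X"
    and scale_add: "\<lbrakk>x \<in> pts X; y \<in> pts X\<rbrakk> \<Longrightarrow>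
          vscale X a (vadd X x y) = vadd X (vscale X a x) (vscale X a y)"
    and add_scale: "x \<in> pts X \<Longrightarrow> vscale X (a + b) x = vadd X (vscale X a x) (vscale X b x)"
    and scale_scale: "x \<in> pts X \<Longrightarrow> vscale X a (vscale X b x) = vscale X (a * b) x"
    and scale_one: "x \<in> pts X \<Longrightarrow> vscale X 1 x = x"
    and norm_nonneg: "x \<in> pts X \<Longrightarrow> 0 \<le> vnorm X x"
    and norm_eq_zero: "x \<in> pts X \<Longrightarrow> vnorm X x = 0 \<longleftrightarrow> x = vzero X"
    and norm_triangle: "\<lbrakk>x \<in> pts X; y \<in> pts X\<rbrakk> \<Longrightarrow> vnorm X (vadd X x y) \<le> vnorm X x + vnorm X y"
    and norm_scale: "x \<in> pts X \<Longrightarrow> vnorm X (vscale X a x) = cmod a * vnorm X x"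

locale complex_banach_space = complex_normed_space +
  assumes complete: "\<lbrakk>\<And>i. u i \<in> pts X;
      \<And>e. e > 0 \<Longrightarrow> \<exists>N. \<forall>i\<ge>N. \<forall>j\<ge>N. vnorm X (vdiff X (u i) (u j)) < e\<rbrakk> \<Longrightarrow>
      \<exists>l\<in>pts X. (\<lambda>i. vnorm X (vdiff X (u i) l)) \<longlonglongrightarrow> 0"

definition clinear_map :: "'a cnspace \<Rightarrow> 'b cnspace \<Rightarrow> ('a \<Rightarrow> 'b) \<Rightarrow> bool" where
  "clinear_map X Y T \<longleftrightarrow>
     (\<forall>x\<in>pts X. T x \<in> pts Y) \<and>
     (\<forall>x\<in>pts X. \<forall>y\<in>pts X. T (vadd X x y) = vadd Y (T x) (T y)) \<and>
     (\<forall>a. \<forall>x\<in>pts X. T (vscale X a x) = vscale Y a (T x))"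

definition bounded_clinear_map :: "'a cnspace \<Rightarrow> 'b cnspace \<Rightarrow> ('a \<Rightarrow> 'b) \<Rightarrow> bool" where
  "bounded_clinear_map X Y T \<longleftrightarrow>
     clinear_map X Y T \<and> (\<exists>K. \<forall>x\<in>pts X. vnorm Y (T x) \<le> K * vnorm X x)"

definition op_norm :: "'a cnspace \<Rightarrow> 'b cnspace \<Rightarrow> ('a \<Rightarrow> 'b) \<Rightarrow> ereal" where
  "op_norm X Y T = (SUP x\<in>{x \<in> pts X. vnorm X x \<le> 1}. ereal (vnorm Y (T x)))"

definition isometric_embedding :: "'a cnspace \<Rightarrow> 'b cnspace \<Rightarrow> ('a \<Rightarrow> 'b) \<Rightarrow> bool" where
  "isometric_embedding X Y I \<longleftrightarrow> clinear_map X Y I \<and> (\<forall>x\<in>pts X. vnorm Y (I x) = vnorm X x)"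

definition restrict_to :: "'a cnspace \<Rightarrow> 'a set \<Rightarrow> 'a cnspace" where
  "restrict_to Y X = Y\<lparr>pts := X\<rparr>"


section \<open>Projections and projection constants\<close>

definition projection_onto :: "'a cnspace \<Rightarrow> 'a set \<Rightarrow> ('a \<Rightarrow> 'a) \<Rightarrow> bool" where
  "projection_onto Y X P \<longleftrightarrow> bounded_clinear_map Y (restrict_to Y X) P \<and> (\<forall>x\<in>X. P x = x)"

definition rel_proj_const :: "'a set \<Rightarrow> 'a cnspace \<Rightarrow> ereal" where
  "rel_proj_const X Y = (INF P\<in>{P. projection_onto Y X P}. op_norm Y (restrict_to Y X) P)"

text \<open>
  HOL has no supremum over the Banach spaces of all types at once.  The supremum below ranges over
  all complex Banach spaces whose points belong to the type \<open>'y\<close>; a statement about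
  the absolute projection constant is obtained by instantiating \<open>'y\<close> with \<open>'z + 'a\<close> and
  leaving \<open>'z\<close> free.  Every Banach space whatsoever (on \<open>'z\<close>) is then admitted, and the
  summand \<open>'a\<close> makes sure that the spaces containing \<open>X\<close> on its own type take part.
\<close>

definition abs_proj_const :: "'y itself \<Rightarrow> 'a cnspace \<Rightarrow> ereal" where
  "abs_proj_const _ X =
     Sup {rel_proj_const (I ` pts X) Y | (Y :: 'y cnspace) I.
            complex_banach_space Y \<and> isometric_embedding X Y I}"


section \<open>Complex-valued functions on the sphere\<close>

text \<open>
  A function on the unit sphere is represented by its extension by zero to the whole of
  \<open>real ^ 'n\<close>.  This representation is unique, respects pointwise operations, and is compatible
  with \<open>f \<circ> A\<close> for orthogonal \<open>A\<close>, which preserves the sphere and its complement.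
\<close>

type_synonym 'n cfun = "real ^ 'n \<Rightarrow> complex"

global_interpretation cfun: vector_space "\<lambda>(c::complex) (f :: 'n::finite cfun) x. c * f x"
  by unfold_locales (auto simp: fun_eq_iff algebra_simps)

definition C_sphere :: "'n::finite cfun cnspace" where
  "C_sphere = \<lparr>
     pts = {f. continuous_on (sphere 0 1) f \<and> (\<forall>x. x \<notin> sphere 0 1 \<longrightarrow> f x = 0)},
     vadd = (\<lambda>f g x. f x + g x),
     vzero = (\<lambda>x. 0),
     vscale = (\<lambda>c f x. c * f x),
     vnorm = (\<lambda>f. SUP x\<in>sphere 0 1. cmod (f x))\<rparr>"

lemma C_sphere_cmod_le:
  assumes "f \<in> pts C_sphere" "x \<in> sphere 0 1"
  shows "cmod (f x) \<le> vnorm C_sphere f"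
proof -
  have "compact ((\<lambda>x. cmod (f x)) ` sphere 0 1)"
    using assms by (intro compact_continuous_image continuous_intros) (auto simp: C_sphere_def)
  then have "bdd_above ((\<lambda>x. cmod (f x)) ` sphere 0 1)"
    by (intro bounded_imp_bdd_above compact_imp_bounded)
  then show ?thesis
    using assms(2) by (auto simp: C_sphere_def intro!: cSUP_upper)
qed

lemma C_sphere_norm_le:
  fixes f :: "'n::finite cfun"
  assumes "\<And>x. x \<in> sphere 0 1 \<Longrightarrow> cmod (f x) \<le> K"
  shows "vnorm C_sphere f \<le> K"
proof -
  have "sphere (0 :: real ^ 'n) 1 \<noteq> {}" by simp
  then show ?thesis
    using assms by (auto simp: C_sphere_def intro!: cSUP_least)
qed

lemma C_sphere_complex_banach_space: "complex_banach_space (C_sphere :: 'n::finite cfun cnspace)"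
proof
  let ?C = "C_sphere :: 'n::finite cfun cnspace"
  have ne: "\<exists>z. z \<in> sphere (0 :: real ^ 'n) 1"
    using vector_choose_size[of 1, where 'a = "real ^ 'n"] by auto
  show nn: "0 \<le> vnorm ?C f" if "f \<in> pts ?C" for f
    using C_sphere_cmod_le[OF that] ne by (meson norm_ge_zero order_trans)
  show "vzero ?C \<in> pts ?C" by (auto simp: C_sphere_def)
  show "vadd ?C f g \<in> pts ?C" if "f \<in> pts ?C" "g \<in> pts ?C" for f g
    using that by (auto simp: C_sphere_def intro!: continuous_intros)
  show sc: "vscale ?C a f \<in> pts ?C" if "f \<in> pts ?C" for f a
    using that by (auto simp: C_sphere_def intro!: continuous_intros)
  show "vnorm ?C f = 0 \<longleftrightarrow> f = vzero ?C" if f: "f \<in> pts ?C" for f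
  proof
    assume "vnorm ?C f = 0"
    then have "f x = 0" for x
      using C_sphere_cmod_le[OF f, of x] f by (cases "x \<in> sphere 0 1") (auto simp: C_sphere_def)
    then show "f = vzero ?C" by (auto simp: C_sphere_def)
  next
    assume "f = vzero ?C"
    then have "vnorm ?C f \<le> 0"
      by (intro C_sphere_norm_le) (auto simp: C_sphere_def)
    then show "vnorm ?C f = 0" using nn[OF f] by simp
  qed
  show "vnorm ?C (vadd ?C f g) \<le> vnorm ?C f + vnorm ?C g"
    if f: "f \<in> pts ?C" and g: "g \<in> pts ?C" for f g
  proof (rule C_sphere_norm_le)
    fix x :: "real ^ 'n" assume x: "x \<in> sphere 0 1"
    show "cmod (vadd ?C f g x) \<le> vnorm ?C f + vnorm ?C g"
      using C_sphere_cmod_le[OF f x] C_sphere_cmod_le[OF g x] norm_triangle_ineq[of "f x" "g x"]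
      by (simp add: C_sphere_def)
  qed
  have le: "vnorm ?C (vscale ?C a f) \<le> cmod a * vnorm ?C f" if f: "f \<in> pts ?C" for f a
  proof (rule C_sphere_norm_le)
    fix x :: "real ^ 'n" assume x: "x \<in> sphere 0 1"
    have "cmod (vscale ?C a f x) = cmod a * cmod (f x)"
      by (simp add: C_sphere_def norm_mult)
    then show "cmod (vscale ?C a f x) \<le> cmod a * vnorm ?C f"
      using C_sphere_cmod_le[OF f x] by (simp add: mult_left_mono)
  qed
  show "vnorm ?C (vscale ?C a f) = cmod a * vnorm ?C f" if f: "f \<in> pts ?C" for f a
  proof (rule antisym[OF le[OF f]])
    show "cmod a * vnorm ?C f \<le> vnorm ?C (vscale ?C a f)"
    proof (cases "a = 0")
      case True
      then show ?thesis using nn[OF sc[OF f]] by simp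
    next
      case False
      have "vscale ?C (inverse a) (vscale ?C a f) = f"
        using False by (auto simp: C_sphere_def)
      then have "vnorm ?C f \<le> cmod (inverse a) * vnorm ?C (vscale ?C a f)"
        using le[OF sc[OF f], of "inverse a" a] by simp
      then show ?thesis using False by (simp add: norm_divide field_simps)
    qed
  qed
  show "\<exists>l\<in>pts ?C. (\<lambda>i. vnorm ?C (vdiff ?C (u i) l)) \<longlonglongrightarrow> 0"
    if u: "\<And>i. u i \<in> pts ?C"
      and c: "\<And>e. e > 0 \<Longrightarrow> \<exists>N. \<forall>i\<ge>N. \<forall>j\<ge>N. vnorm ?C (vdiff ?C (u i) (u j)) < e" for u
  proof -
    have d: "vdiff ?C f g \<in> pts ?C" if "f \<in> pts ?C" "g \<in> pts ?C" for f g
      using that by (auto simp: C_sphere_def vdiff_def intro!: continuous_intros)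
    have dx: "vdiff ?C f g x = f x - g x" for f g x
      by (simp add: C_sphere_def vdiff_def)
    have "uniformly_Cauchy_on (sphere 0 1) u"
      unfolding uniformly_Cauchy_on_def
    proof (intro allI impI)
      fix e :: real assume "e > 0"
      then obtain N where N: "\<forall>i\<ge>N. \<forall>j\<ge>N. vnorm ?C (vdiff ?C (u i) (u j)) < e"
        using c by blast
      have "dist (u m x) (u n x) < e" if "x \<in> sphere 0 1" "m \<ge> N" "n \<ge> N" for x m n
        using N that C_sphere_cmod_le[OF d[OF u u] that(1), of m n]
        by (auto simp: dx dist_norm intro: le_less_trans)
      then show "\<exists>M. \<forall>x\<in>sphere 0 1. \<forall>m\<ge>M. \<forall>n\<ge>M. dist (u m x) (u n x) < e"
        by blast
    qed
    then obtain l where l: "uniform_limit (sphere 0 1) u l sequentially"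
      by (auto simp: uniformly_convergent_on_def dest!: Cauchy_uniformly_convergent)
    define l' where "l' x = (if x \<in> sphere 0 1 then l x else 0)" for x
    have l': "uniform_limit (sphere 0 1) u l' sequentially"
      using l by (subst uniform_limit_cong'[where g = u and i = l]) (auto simp: l'_def)
    have "continuous_on (sphere 0 1) l'"
      by (rule uniform_limit_theorem[OF _ l']) (use u in \<open>auto simp: C_sphere_def\<close>)
    then have lC: "l' \<in> pts ?C" by (auto simp: C_sphere_def l'_def)
    have "(\<lambda>i. vnorm ?C (vdiff ?C (u i) l')) \<longlonglongrightarrow> 0"
    proof (rule LIMSEQ_I)
      fix e :: real assume e: "e > 0"
      then have "\<forall>\<^sub>F i in sequentially. \<forall>x\<in>sphere 0 1. dist (u i x) (l' x) < e / 2"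
        by (intro uniform_limitD[OF l']) auto
      then obtain N where N: "\<And>i x. i \<ge> N \<Longrightarrow> x \<in> sphere 0 1 \<Longrightarrow> dist (u i x) (l' x) < e / 2"
        unfolding eventually_sequentially by blast
      have "norm (vnorm ?C (vdiff ?C (u i) l') - 0) < e" if "i \<ge> N" for i
      proof -
        have "vnorm ?C (vdiff ?C (u i) l') \<le> e / 2"
          using N[OF that] by (intro C_sphere_norm_le) (auto simp: dx dist_norm intro: less_imp_le)
        then show ?thesis using nn[OF d[OF u lC], of i] e by simp
      qed
      then show "\<exists>N. \<forall>i\<ge>N. norm (vnorm ?C (vdiff ?C (u i) l') - 0) < e" by blast
    qed
    then show ?thesis using lC by blast
  qed
qed (simp_all add: C_sphere_def vdiff_def fun_eq_iff distrib_left distrib_right)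

definition finite_dim_subspace :: "'n::finite cfun set \<Rightarrow> bool" where
  "finite_dim_subspace S \<longleftrightarrow>
     S \<subseteq> pts C_sphere \<and> cfun.subspace S \<and> (\<exists>B. finite B \<and> cfun.span B = S)"

definition orthogonal_invariant :: "'n::finite cfun set \<Rightarrow> bool" where
  "orthogonal_invariant S \<longleftrightarrow> (\<forall>f\<in>S. \<forall>A. orthogonal_transformation A \<longrightarrow> f \<circ> A \<in> S)"

definition equivariant_projection :: "'n::finite cfun set \<Rightarrow> ('n cfun \<Rightarrow> 'n cfun) \<Rightarrow> bool" where
  "equivariant_projection S Q \<longleftrightarrow>
     projection_onto C_sphere S Q \<and>
     (\<forall>f\<in>pts C_sphere. \<forall>A. orthogonal_transformation A \<longrightarrow> Q (f \<circ> A) = Q f \<circ> A)"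


section \<open>Normalized surface measure, orthogonal projection, reproducing kernel\<close>

text \<open>
  Normalized surface measure via polar coordinates: the image of the uniform distribution on the
  unit ball under \<open>x \<mapsto> x / norm x\<close>, i.e. the normalized cone measure.  (The origin, which is
  sent to \<open>0\<close>, is a null set.)  In dimension one this gives mass \<open>1/2\<close> to each of the two points.
\<close>

definition sphere_measure :: "(real ^ 'n) measure" where
  "sphere_measure =
     restrict_space
       (distr (uniform_measure lborel (cball 0 1)) borel (\<lambda>x. x /\<^sub>R norm x)) (sphere 0 1)"

lemma
  shows space_sphere_measure: "space (sphere_measure :: (real ^ 'n) measure) = sphere 0 1"
    and sets_sphere_measure:
      "sets (sphere_measure :: (real ^ 'n) measure) = sets (restrict_space borel (sphere 0 1))"
  by (simp_all add: sphere_measure_def space_restrict_space sets_restrict_space)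

lemma emeasure_sphere_measure:
  assumes "A \<in> sets (sphere_measure :: (real ^ 'n) measure)"
  shows "emeasure sphere_measure A =
    emeasure lborel (cball (0 :: real ^ 'n) 1 \<inter> (\<lambda>x. x /\<^sub>R norm x) -` A) / emeasure lborel (cball (0 :: real ^ 'n) 1)"
proof -
  have A: "A \<subseteq> sphere 0 1" "A \<in> sets borel"
    using assms by (auto simp: sets_sphere_measure sets_restrict_space)
  have m: "(\<lambda>x :: real ^ 'n. x /\<^sub>R norm x) \<in> borel_measurable borel"
    by measurable
  show ?thesis
    using A measurable_sets[OF m A(2)] m
    by (simp add: sphere_measure_def emeasure_restrict_space emeasure_distr)
qed

lemma prob_space_sphere_measure: "prob_space (sphere_measure :: (real ^ 'n) measure)"
proof
  let ?D = "cball (0 :: real ^ 'n) 1"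
  let ?V = "(\<lambda>x :: real ^ 'n. x /\<^sub>R norm x) -` sphere 0 1"
  have eq: "?D \<inter> ?V = ?D - {0}"
    by (auto simp: norm_inverse)
  have fin: "emeasure lborel ?D \<noteq> \<infinity>"
    using emeasure_bounded_finite[of ?D] by auto
  have pos: "emeasure lborel ?D \<noteq> 0"
  proof -
    have "0 < emeasure lborel (ball (0 :: real ^ 'n) 1)"
      by (simp add: emeasure_lborel_ball_finite emeasure_ball unit_ball_vol_pos ennreal_zero_less_mult_iff)
    also have "\<dots> \<le> emeasure lborel ?D"
      by (rule emeasure_mono) auto
    finally show ?thesis by simp
  qed
  have "emeasure lborel (?D - {0}) = emeasure lborel ?D"
    by (rule emeasure_Diff_null_set) (auto simp: null_sets_def)
  moreover have "sphere 0 1 \<in> sets (sphere_measure :: (real ^ 'n) measure)"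
    using sets.top[of "sphere_measure :: (real ^ 'n) measure"] by (simp add: space_sphere_measure)
  ultimately show "emeasure sphere_measure (space (sphere_measure :: (real ^ 'n) measure)) = 1"
    using fin pos by (simp add: space_sphere_measure emeasure_sphere_measure eq ennreal_divide_self top.not_eq_extremum)
qed

lemma sphere_measure_rotation_invariant:
  fixes T :: "real ^ 'n::{finite, wellorder} \<Rightarrow> real ^ 'n::{finite, wellorder}"
  assumes T: "orthogonal_transformation T" and A: "A \<in> sets sphere_measure"
  shows "emeasure sphere_measure (T ` A) = emeasure sphere_measure A"
proof -
  let ?p = "\<lambda>x :: real ^ 'n::{finite, wellorder}. x /\<^sub>R norm x"
  let ?D = "cball 0 1 :: (real ^ 'n::{finite, wellorder}) set"
  have p: "?p \<in> borel_measurable borel" by measurable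
  have A': "A \<subseteq> sphere 0 1" "A \<in> sets borel"
    using A by (auto simp: sets_sphere_measure sets_restrict_space)
  obtain U where U: "orthogonal_transformation U" "\<And>x. U (T x) = x" "\<And>x. T (U x) = x"
    using that[of "inv T"] T orthogonal_transformation_inv[OF T] orthogonal_transformation_inj[OF T]
      orthogonal_transformation_surj[OF T] by (simp add: inv_f_f surj_f_inv_f)
  have nT: "norm (T x) = norm x" and nU: "norm (U x) = norm x" for x
    using T U(1) by (auto simp: orthogonal_transformation_norm)
  have sT: "T (c *\<^sub>R x) = c *\<^sub>R T x" and sU: "U (c *\<^sub>R x) = c *\<^sub>R U x" for c x
    using T U(1) by (auto simp: orthogonal_transformation_def linear_cmul)
  have im: "T ` B = U -` B" for B
  proof safe
    fix x assume "U x \<in> B"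
    then show "x \<in> T ` B" using U(3)[of x] by (intro image_eqI[where x = "U x"]) auto
  qed (simp add: U(2))
  have "U \<in> borel_measurable borel"
    using U(1) by (intro borel_measurable_continuous_onI linear_continuous_on)
      (simp add: orthogonal_transformation_def linear_conv_bounded_linear)
  then have mT: "T ` B \<in> sets borel" if "B \<in> sets borel" for B
    using measurable_sets[of U borel borel B] that by (simp add: im)
  have TA: "T ` A \<in> sets sphere_measure"
  proof -
    have "T ` A = sphere 0 1 \<inter> T ` A" using A'(1) by (auto simp: nT)
    then show ?thesis using mT[OF A'(2)] by (auto simp: sets_sphere_measure sets_restrict_space)
  qed
  let ?W = "?D \<inter> ?p -` A"
  have W: "?W \<in> sets borel"
    using measurable_sets[OF p A'(2)] by simp
  have "?D \<inter> ?p -` (T ` A) = T ` ?W"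
    by (auto simp: im nU sU)
  moreover have "?W \<in> lmeasurable"
    by (rule bounded_set_imp_lmeasurable) (use W in \<open>auto intro: bounded_Int\<close>)
  then have "emeasure lebesgue (T ` ?W) = emeasure lebesgue ?W"
    using measurable_orthogonal_image[OF T] measure_orthogonal_image[OF T]
    by (simp add: emeasure_eq_measure2)
  then have "emeasure lborel (T ` ?W) = emeasure lborel ?W"
    using W mT by simp
  ultimately show ?thesis
    using A TA by (simp add: emeasure_sphere_measure)
qed

definition l2_inner :: "'n::finite cfun \<Rightarrow> 'n cfun \<Rightarrow> complex" where
  "l2_inner f g = (LINT y|sphere_measure. f y * cnj (g y))"

text \<open>Orthogonal projection onto \<open>S\<close>, meaningful for square-integrable arguments.\<close>

definition l2_proj :: "'n::finite cfun set \<Rightarrow> 'n cfun \<Rightarrow> 'n cfun" where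
  "l2_proj S f = (THE g. g \<in> S \<and> (\<forall>h\<in>S. l2_inner (\<lambda>x. f x - g x) h = 0))"

definition orthonormal_basis :: "'n::finite cfun set \<Rightarrow> 'n cfun set \<Rightarrow> bool" where
  "orthonormal_basis S B \<longleftrightarrow>
     finite B \<and> cfun.span B = S \<and> (\<forall>f\<in>B. \<forall>g\<in>B. l2_inner f g = (if f = g then 1 else 0))"

definition first_unit_vector :: "real ^ 'n::{finite, wellorder}" where
  "first_unit_vector = axis (LEAST i. True) 1"

text \<open>The choice of the basis is immaterial.\<close>

definition repr_kernel :: "'n::finite cfun set \<Rightarrow> real ^ 'n \<Rightarrow> real ^ 'n \<Rightarrow> complex" where
  "repr_kernel S x y = (\<Sum>f\<in>(SOME B. orthonormal_basis S B). cnj (f x) * f y)"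

end

theory Submission
  imports Defs
begin

text \<open>
  The lower bound averages a projection \<open>P\<close> from \<open>C\<close> onto \<open>S\<close> over the orthogonal group:
  \<open>f \<mapsto> \<integral> P (f \<circ> A) \<circ> A\<^sup>-\<^sup>1 dA\<close> is an equivariant projection whose norm is at most that of \<open>P\<close>, so by
  uniqueness it is \<open>\<pi>\<^sub>S\<close>.  Haar measure is the law of the Gram--Schmidt frame of independent random
  points of the sphere, and its left invariance comes from that of \<open>\<sigma>\<^sub>n\<close>.  The norm of \<open>\<pi>\<^sub>S\<close> is the
  supremum over \<open>x\<close> of \<open>\<integral> \<bar>k\<^sub>S(x, y)\<bar> d\<sigma>\<^sub>n(y)\<close>, and by equivariance this integral does not depend
  on \<open>x\<close>.  For the upper bound, let \<open>I\<close> embed \<open>S\<close> isometrically in a Banach space \<open>Y\<close>.  Replace the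
  integral \<open>f \<mapsto> \<integral> f(y) cnj (k\<^sub>S(x, y)) d\<sigma>\<^sub>n(y)\<close> by a fine quadrature, which involves only finitely
  many point evaluations on \<open>S\<close>; by Hahn--Banach these extend to norm-one functionals on \<open>Y\<close>.
\<close>

section \<open>Hahn--Banach for complex normed spaces with explicit carrier\<close>

text \<open>The extensions of the point evaluations to \<open>Y\<close> are chosen separately for
  each point, with no measurable dependence on it, so they cannot simply be integrated against the
  kernel. A finite quadrature avoids this but reproduces \<open>S\<close> only approximately,
  whereas a projection has to fix \<open>S\<close> exactly. The defect is cancelled with
  Hahn--Banach extensions of the coefficient functionals, at a cost that is made small by refining
  the mesh. The upper bound is therefore obtained up to every \<open>e > 0\<close>, which is enough
  for an infimum.

  Since \<open>S\<close> is finite-dimensional, the integral over the group is one of finitely many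
  scalar coefficients. The lower bound needs a single superspace, the space of continuous functions,
  because the projection constant is a supremum.

  Hahn--Banach itself goes through minimal sublinear functionals instead of extensions by one
  dimension at a time: all functionals involved are then defined on the whole carrier.\<close>

context complex_normed_space
begin

definition sublinear :: "('a \<Rightarrow> real) \<Rightarrow> bool" where
  "sublinear q \<longleftrightarrow>
     (\<forall>x\<in>pts X. \<forall>y\<in>pts X. q (vadd X x y) \<le> q x + q y) \<and>
     (\<forall>t\<ge>0. \<forall>x\<in>pts X. q (vscale X (of_real t) x) = t * q x)"

lemma sublinear_add: "\<lbrakk>sublinear q; x \<in> pts X; y \<in> pts X\<rbrakk> \<Longrightarrow> q (vadd X x y) \<le> q x + q y"
  by (simp add: sublinear_def)

lemma sublinear_scale:
  "\<lbrakk>sublinear q; x \<in> pts X; 0 \<le> t\<rbrakk> \<Longrightarrow> q (vscale X (of_real t) x) = t * q x"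
  by (simp add: sublinear_def)

lemma scale_zero_left: "x \<in> pts X \<Longrightarrow> vscale X 0 x = vzero X"
  using add_scale[of x 1 "-1"] diff_self[of x] by (simp add: vdiff_def scale_one)

lemma scale_zero_right: "vscale X a (vzero X) = vzero X"
  using scale_scale[OF zero_in, of a 0] by (simp add: scale_zero_left zero_in)

lemma add_zero: "x \<in> pts X \<Longrightarrow> vadd X x (vzero X) = x"
  using add_commute zero_add zero_in by metis

lemma add_neg: "x \<in> pts X \<Longrightarrow> vadd X x (vscale X (- 1) x) = vzero X"
  using diff_self by (simp add: vdiff_def)

lemma add_neg_cancel:
  assumes "x \<in> pts X" "y \<in> pts X"
  shows "vadd X (vadd X y x) (vscale X (- 1) y) = x"
proof -
  have "vadd X (vadd X y x) (vscale X (- 1) y) = vadd X x (vadd X y (vscale X (- 1) y))"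
    using assms add_commute[of y x] add_assoc[of x y] scale_in by metis
  then show ?thesis using assms by (simp add: add_neg add_zero)
qed

lemma add_add_swap:
  assumes "x \<in> pts X" "y \<in> pts X" "z \<in> pts X" "w \<in> pts X"
  shows "vadd X (vadd X x y) (vadd X z w) = vadd X (vadd X x z) (vadd X y w)"
  using assms by (metis add_assoc add_commute add_in)

lemma sublinear_zero: "sublinear q \<Longrightarrow> q (vzero X) = 0"
  using sublinear_scale[OF _ zero_in, of q 0] by (simp add: scale_zero_left zero_in)

lemma sublinear_neg: "\<lbrakk>sublinear q; x \<in> pts X\<rbrakk> \<Longrightarrow> - q (vscale X (- 1) x) \<le> q x"
  using sublinear_add[of q x "vscale X (- 1) x"] sublinear_zero[of q] scale_in[of x "-1"]
  by (simp add: add_neg)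

text \<open>
  The largest sublinear functional below \<open>p\<close> that lies below \<open>y \<mapsto> - \<phi> (- y)\<close> on \<open>- C\<close>.  For a
  subspace \<open>C\<close> this encodes the extension problem for \<open>\<phi>\<close>; for a half-line \<open>C\<close> it shows that
  minimal sublinear functionals are additive.
\<close>

definition cone_inf :: "('a \<Rightarrow> real) \<Rightarrow> 'a set \<Rightarrow> ('a \<Rightarrow> real) \<Rightarrow> 'a \<Rightarrow> real" where
  "cone_inf p C \<phi> y = (INF x\<in>C. p (vadd X y x) - \<phi> x)"

definition cone_dominated :: "('a \<Rightarrow> real) \<Rightarrow> 'a set \<Rightarrow> ('a \<Rightarrow> real) \<Rightarrow> bool" where
  "cone_dominated p C \<phi> \<longleftrightarrow>
     C \<subseteq> pts X \<and> vzero X \<in> C \<and> (\<forall>x\<in>C. \<forall>y\<in>C. vadd X x y \<in> C) \<and>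
     (\<forall>t\<ge>0. \<forall>x\<in>C. vscale X (complex_of_real t) x \<in> C) \<and>
     (\<forall>x\<in>C. \<forall>y\<in>C. \<phi> (vadd X x y) = \<phi> x + \<phi> y) \<and>
     (\<forall>t\<ge>0. \<forall>x\<in>C. \<phi> (vscale X (complex_of_real t) x) = t * \<phi> x) \<and>
     (\<forall>x\<in>C. \<phi> x \<le> p x)"

context
  fixes p \<phi> :: "'a \<Rightarrow> real" and C :: "'a set"
  assumes p: "sublinear p" and dom: "cone_dominated p C \<phi>"
begin

private lemma C: "C \<subseteq> pts X" "vzero X \<in> C" "x \<in> C \<Longrightarrow> y \<in> C \<Longrightarrow> vadd X x y \<in> C"
      "0 \<le> t \<Longrightarrow> x \<in> C \<Longrightarrow> vscale X (complex_of_real t) x \<in> C"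
  and \<phi>: "x \<in> C \<Longrightarrow> y \<in> C \<Longrightarrow> \<phi> (vadd X x y) = \<phi> x + \<phi> y"
      "0 \<le> t \<Longrightarrow> x \<in> C \<Longrightarrow> \<phi> (vscale X (complex_of_real t) x) = t * \<phi> x"
      "x \<in> C \<Longrightarrow> \<phi> x \<le> p x"
  using dom by (auto simp: cone_dominated_def)

text \<open>The infimum is over a set bounded below:
  \<open>\<phi> x \<le> p x \<le> p (y + x) + p (- y)\<close> for \<open>x\<close> in
  \<open>C\<close>, so no candidate lies below \<open>- p (- y)\<close>.\<close>

lemma cone_inf_upper:
  assumes "y \<in> pts X" "x \<in> C"
  shows "cone_inf p C \<phi> y \<le> p (vadd X y x) - \<phi> x"
  unfolding cone_inf_def
proof (rule cINF_lower)
  have "- p (vscale X (- 1) y) \<le> p (vadd X y x) - \<phi> x" if "x \<in> C" for x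
  proof -
    have x: "x \<in> pts X" using that C by auto
    have "p x \<le> p (vadd X y x) + p (vscale X (- 1) y)"
      using sublinear_add[OF p add_in[OF assms(1) x] scale_in[OF assms(1)], of "-1"]
      by (simp add: add_neg_cancel assms x)
    with \<phi>(3)[OF that] show ?thesis by simp
  qed
  then show "bdd_below ((\<lambda>x. p (vadd X y x) - \<phi> x) ` C)"
    by (auto intro!: bdd_belowI2)
qed (fact assms)

lemma cone_inf_greatest:
  assumes "\<And>x. x \<in> C \<Longrightarrow> m \<le> p (vadd X y x) - \<phi> x"
  shows "m \<le> cone_inf p C \<phi> y"
  unfolding cone_inf_def using assms C(2) by (intro cINF_greatest) auto

lemma cone_zero: "\<phi> (vzero X) = 0"
  using \<phi>(2)[of 0 "vzero X"] C(2) by (simp add: scale_zero_right)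

lemma cone_inf_le: "y \<in> pts X \<Longrightarrow> cone_inf p C \<phi> y \<le> p y"
  using cone_inf_upper[OF _ C(2)] by (simp add: cone_zero add_zero)

text \<open>Candidates \<open>a\<close> for \<open>y\<close> and \<open>b\<close> for
  \<open>z\<close> add up to the candidate \<open>a + b\<close> for \<open>y + z\<close>. For
  homogeneity one inequality for all \<open>t > 0\<close> suffices, since applying it to
  \<open>inverse t\<close> gives the other; at \<open>t = 0\<close> the value is 0 because
  \<open>\<phi> \<le> p\<close> on \<open>C\<close>.\<close>

lemma sublinear_cone_inf: "sublinear (cone_inf p C \<phi>)"
  unfolding sublinear_def
proof (intro conjI ballI allI impI)
  let ?r = "cone_inf p C \<phi>"
  fix y z assume y: "y \<in> pts X" and z: "z \<in> pts X"
  have "?r (vadd X y z) \<le> (p (vadd X y a) - \<phi> a) + (p (vadd X z b) - \<phi> b)"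
    if "a \<in> C" "b \<in> C" for a b
  proof -
    have ab: "a \<in> pts X" "b \<in> pts X" using that C by auto
    have "?r (vadd X y z) \<le> p (vadd X (vadd X y z) (vadd X a b)) - \<phi> (vadd X a b)"
      using that by (intro cone_inf_upper add_in C y z)
    also have "vadd X (vadd X y z) (vadd X a b) = vadd X (vadd X y a) (vadd X z b)"
      using y z ab by (rule add_add_swap)
    also have "p \<dots> - \<phi> (vadd X a b) \<le> (p (vadd X y a) - \<phi> a) + (p (vadd X z b) - \<phi> b)"
      using sublinear_add[OF p add_in[OF y ab(1)] add_in[OF z ab(2)]] \<phi>(1)[OF that] by simp
    finally show ?thesis .
  qed
  then have "?r (vadd X y z) - (p (vadd X z b) - \<phi> b) \<le> ?r y" if "b \<in> C" for b
    using that by (intro cone_inf_greatest) (simp add: algebra_simps)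
  then have "?r (vadd X y z) - ?r y \<le> ?r z"
    by (intro cone_inf_greatest) (simp add: algebra_simps)
  then show "?r (vadd X y z) \<le> ?r y + ?r z" by simp
next
  let ?r = "cone_inf p C \<phi>"
  have le: "?r (vscale X (complex_of_real t) y) \<le> t * ?r y" if t: "0 < t" and y: "y \<in> pts X" for t y
  proof -
    have "?r (vscale X (complex_of_real t) y) / t \<le> ?r y"
    proof (rule cone_inf_greatest)
      fix x assume x: "x \<in> C"
      then have x': "x \<in> pts X" using C by auto
      have "?r (vscale X (complex_of_real t) y)
          \<le> p (vadd X (vscale X t y) (vscale X t x)) - \<phi> (vscale X (complex_of_real t) x)"
        using t x y by (intro cone_inf_upper C scale_in) auto
      also have "\<dots> = t * (p (vadd X y x) - \<phi> x)"
        using t x x' y sublinear_scale[OF p add_in[OF y x'], of t] \<phi>(2)[of t x]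
        by (simp add: scale_add[symmetric] algebra_simps)
      finally show "?r (vscale X (complex_of_real t) y) / t \<le> p (vadd X y x) - \<phi> x"
        using t by (simp add: field_simps)
    qed
    then show ?thesis using t by (simp add: field_simps)
  qed
  fix t :: real and y assume t: "0 \<le> t" and y: "y \<in> pts X"
  show "?r (vscale X (complex_of_real t) y) = t * ?r y"
  proof (cases "t = 0")
    case True
    have "0 \<le> ?r (vzero X)"
      using C(1) \<phi>(3) by (intro cone_inf_greatest) (auto simp: zero_add)
    moreover have "?r (vzero X) \<le> 0"
      using cone_inf_le[OF zero_in] sublinear_zero[OF p] by simp
    ultimately show ?thesis using True y by (simp add: scale_zero_left)
  next
    case False
    then have "?r y \<le> inverse t * ?r (vscale X (complex_of_real t) y)"
      using le[of "inverse t" "vscale X (complex_of_real t) y"] t y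
      by (simp add: scale_in scale_scale scale_one of_real_mult[symmetric] del: of_real_inverse of_real_mult)
    then show ?thesis
      using False t le[of t y] y by (intro antisym) (auto simp: field_simps)
  qed
qed

end

text \<open>The infimum is finite because \<open>- p (- x) \<le> - q (- x) \<le> q x\<close> for
  every \<open>q\<close> in the chain. Subadditivity is where the chain matters: two members used at
  \<open>x\<close> and at \<open>y\<close> are replaced by the smaller one.\<close>

lemma sublinear_chain_inf:
  assumes "C \<noteq> {}" "\<forall>q\<in>C. sublinear q" "\<forall>q\<in>C. \<forall>x\<in>pts X. q x \<le> p x"
    and "\<forall>q\<in>C. \<forall>r\<in>C. (\<forall>x\<in>pts X. q x \<le> r x) \<or> (\<forall>x\<in>pts X. r x \<le> q x)"
  shows "sublinear (\<lambda>x. INF q\<in>C. q x)"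
    and "q \<in> C \<Longrightarrow> x \<in> pts X \<Longrightarrow> (INF q\<in>C. q x) \<le> q x"
proof -
  note C = assms(1) assms(2)[rule_format]
  note bd = assms(3)[rule_format]
  have low: "(INF q\<in>C. q x) \<le> q x" if "q \<in> C" "x \<in> pts X" for q x
  proof (rule cINF_lower[OF _ that(1)])
    have "- p (vscale X (- 1) x) \<le> r x" if "r \<in> C" for r
      using sublinear_neg[OF C(2)[OF that] \<open>x \<in> pts X\<close>] bd[OF that scale_in[OF \<open>x \<in> pts X\<close>], of "-1"]
      by simp
    then show "bdd_below ((\<lambda>q. q x) ` C)" by (intro bdd_belowI2) auto
  qed
  then show "q \<in> C \<Longrightarrow> x \<in> pts X \<Longrightarrow> (INF q\<in>C. q x) \<le> q x" .
  show "sublinear (\<lambda>x. INF q\<in>C. q x)"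
    unfolding sublinear_def
  proof (intro conjI ballI allI impI)
    fix x y assume xy: "x \<in> pts X" "y \<in> pts X"
    have *: "(INF q\<in>C. q (vadd X x y)) \<le> q x + r y" if "q \<in> C" "r \<in> C" for q r
    proof -
      obtain s where s: "s \<in> C" "\<forall>x\<in>pts X. s x \<le> q x \<and> s x \<le> r x"
        using assms(4) \<open>q \<in> C\<close> \<open>r \<in> C\<close> by (metis order_refl)
      have "(INF q\<in>C. q (vadd X x y)) \<le> s (vadd X x y)"
        using s xy by (intro low add_in)
      also have "\<dots> \<le> s x + s y" using C(2)[OF s(1)] xy by (rule sublinear_add)
      also have "\<dots> \<le> q x + r y" using s xy by (intro add_mono) auto
      finally show ?thesis .
    qed
    have "(INF q\<in>C. q (vadd X x y)) - r y \<le> (INF q\<in>C. q x)" if "r \<in> C" for r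
      using * that C(1) by (intro cINF_greatest) (auto simp: algebra_simps)
    then have "(INF q\<in>C. q (vadd X x y)) - (INF q\<in>C. q x) \<le> (INF q\<in>C. q y)"
      using C(1) by (intro cINF_greatest) (auto simp: algebra_simps)
    then show "(INF q\<in>C. q (vadd X x y)) \<le> (INF q\<in>C. q x) + (INF q\<in>C. q y)" by simp
  next
    fix t :: real and x assume t: "0 \<le> t" and x: "x \<in> pts X"
    have "(\<lambda>q. q (vscale X (complex_of_real t) x)) ` C = (\<lambda>q. t * q x) ` C"
      using sublinear_scale[OF C(2) x t] by (intro image_cong) auto
    moreover have "(INF q\<in>C. t * q x) = t * (INF q\<in>C. q x)"
    proof (cases "t = 0")
      case True
      then show ?thesis using C(1) by simp
    next
      case False
      with t have t': "0 < t" by simp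
      show ?thesis
      proof (rule antisym)
        have bdd: "bdd_below ((\<lambda>q. t * q x) ` C)"
          using low[OF _ x] t by (intro bdd_belowI2[where m = "t * (INF q\<in>C. q x)"] mult_left_mono) auto
        have "(INF q\<in>C. t * q x) / t \<le> (INF q\<in>C. q x)"
          using C(1) t' bdd by (intro cINF_greatest) (auto simp: field_simps intro!: cINF_lower)
        then show "(INF q\<in>C. t * q x) \<le> t * (INF q\<in>C. q x)" using t' by (simp add: field_simps)
        show "t * (INF q\<in>C. q x) \<le> (INF q\<in>C. t * q x)"
          using C(1) t low[OF _ x] by (intro cINF_greatest mult_left_mono) auto
      qed
    qed
    ultimately show "(INF q\<in>C. q (vscale X (complex_of_real t) x)) = t * (INF q\<in>C. q x)" by simp
  qed
qed

lemma ex_minimal_sublinear: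
  assumes p: "sublinear p"
  obtains q where "sublinear q" "\<And>x. x \<in> pts X \<Longrightarrow> q x \<le> p x"
    "\<And>r x. \<lbrakk>sublinear r; \<And>x. x \<in> pts X \<Longrightarrow> r x \<le> q x; x \<in> pts X\<rbrakk> \<Longrightarrow> r x = q x"
proof -
  \<comment> \<open>Functionals are normalized to 0 outside the carrier, for otherwise the
    comparison on \<open>pts X\<close> would not be antisymmetric. The order \<open>?P\<close> is
    reversed, so a maximal element for Zorn is a minimal functional.\<close>
  let ?A = "{q. sublinear q \<and> (\<forall>x\<in>pts X. q x \<le> p x) \<and> (\<forall>x. x \<notin> pts X \<longrightarrow> q x = 0)}"
  let ?P = "\<lambda>q r. \<forall>x\<in>pts X. r x \<le> q x"
  let ?cut = "\<lambda>q x. if x \<in> pts X then q x else (0::real)"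
  have cut: "sublinear (?cut q)" if "sublinear q" for q
    using that unfolding sublinear_def by (auto simp: add_in scale_in)
  have "\<exists>m\<in>?A. \<forall>a\<in>?A. ?P m a \<longrightarrow> a = m"
  proof (rule predicate_Zorn)
    show "partial_order_on ?A (relation_of ?P ?A)"
    proof (rule partial_order_on_relation_ofI)
      fix q r assume "q \<in> ?A" "r \<in> ?A" "?P q r" "?P r q"
      then have "q x = r x" for x
        by (cases "x \<in> pts X") (auto intro: antisym)
      then show "q = r" by auto
    qed (auto intro: order_trans)
    fix C assume "C \<in> Chains (relation_of ?P ?A)"
    then have CA: "C \<subseteq> ?A" and ch: "\<forall>q\<in>C. \<forall>r\<in>C. (\<forall>x\<in>pts X. q x \<le> r x) \<or> (\<forall>x\<in>pts X. r x \<le> q x)"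
      unfolding Chains_def relation_of_def by blast+
    show "\<exists>u\<in>?A. \<forall>a\<in>C. ?P a u"
    proof (cases "C = {}")
      case True
      then show ?thesis using p cut[OF p] by (intro bexI[of _ "?cut p"]) auto
    next
      case False
      let ?u = "\<lambda>x. INF q\<in>C. q x"
      have sub: "\<forall>q\<in>C. sublinear q" and bd: "\<forall>q\<in>C. \<forall>x\<in>pts X. q x \<le> p x"
        using CA by auto
      note u = sublinear_chain_inf[OF False sub bd ch]
      have "?u x \<le> p x" if "x \<in> pts X" for x
        using u(2)[OF _ that] bd that False by (metis all_not_in_conv order_trans)
      then have "?cut ?u \<in> ?A"
        using cut[OF u(1)] by auto
      then show ?thesis using u(2) by (intro bexI[of _ "?cut ?u"]) auto
    qed
  qed
  then obtain q where q: "q \<in> ?A" and min: "\<And>r. r \<in> ?A \<Longrightarrow> ?P q r \<Longrightarrow> r = q" by blast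
  show thesis
  proof
    fix r x assume r: "sublinear r" "\<And>x. x \<in> pts X \<Longrightarrow> r x \<le> q x" and x: "x \<in> pts X"
    have "?cut r \<in> ?A"
    proof -
      have "r y \<le> p y" if "y \<in> pts X" for y
        using r(2)[OF that] q that by fastforce
      then show ?thesis using cut[OF r(1)] by simp
    qed
    then have "?cut r = q" using r(2) by (intro min) auto
    from fun_cong[OF this, of x] show "r x = q x" using x by simp
  qed (use q in auto)
qed

text \<open>Take for the cone the half-line through \<open>y\<close> and for \<open>\<phi>\<close>
  the functional \<open>q\<close> itself. The resulting \<open>cone_inf\<close> is sublinear and
  below \<open>q\<close>, hence equals \<open>q\<close>; the candidate \<open>y\<close> in the
  infimum then gives \<open>q x \<le> q (x + y) - q y\<close>.\<close>

lemma minimal_sublinear_add: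
  assumes q: "sublinear q"
    and min: "\<And>r x. \<lbrakk>sublinear r; \<And>x. x \<in> pts X \<Longrightarrow> r x \<le> q x; x \<in> pts X\<rbrakk> \<Longrightarrow> r x = q x"
    and xy: "x \<in> pts X" "y \<in> pts X"
  shows "q (vadd X x y) = q x + q y"
proof (rule antisym)
  let ?C = "{vscale X (complex_of_real t) y | t. 0 \<le> t}"
  have "cone_dominated q ?C q"
    unfolding cone_dominated_def
  proof (intro conjI ballI allI impI)
    show "vzero X \<in> ?C" using xy scale_zero_left[of y] by (auto intro!: exI[of _ 0])
    show "vadd X u v \<in> ?C" if "u \<in> ?C" "v \<in> ?C" for u v
    proof -
      from that obtain s t where "u = vscale X (complex_of_real s) y" "0 \<le> s" "v = vscale X (complex_of_real t) y" "0 \<le> t"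
        by auto
      then show ?thesis using xy by (auto simp: add_scale intro!: exI[of _ "s + t"])
    qed
    show "vscale X (complex_of_real t) u \<in> ?C" if "0 \<le> t" "u \<in> ?C" for t u
    proof -
      from that obtain s where "u = vscale X (complex_of_real s) y" "0 \<le> s"
        by auto
      then show ?thesis using xy that(1) by (auto simp: scale_scale intro!: exI[of _ "t * s"])
    qed
    show "q (vadd X u v) = q u + q v" if "u \<in> ?C" "v \<in> ?C" for u v
    proof -
      from that obtain s t where st: "u = vscale X (complex_of_real s) y" "0 \<le> s" "v = vscale X (complex_of_real t) y" "0 \<le> t"
        by auto
      then have "vadd X u v = vscale X (complex_of_real (s + t)) y"
        using xy by (simp add: add_scale)
      then show ?thesis using st xy by (simp add: sublinear_scale[OF q] distrib_right del: of_real_add)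
    qed
    show "q (vscale X (complex_of_real t) u) = t * q u" if "0 \<le> t" "u \<in> ?C" for t u
      using that xy by (intro sublinear_scale[OF q]) (auto intro: scale_in)
  qed (use xy in \<open>auto intro: scale_in\<close>)
  note r = sublinear_cone_inf[OF q this] cone_inf_le[OF q this] cone_inf_upper[OF q this]
  have "q x = cone_inf q ?C q x"
    using min[OF r(1) r(2) xy(1)] by simp
  also have "\<dots> \<le> q (vadd X x y) - q y"
    using xy scale_one[OF xy(2)] by (intro r(3)) (auto intro!: exI[of _ 1])
  finally show "q x + q y \<le> q (vadd X x y)" by simp
qed (rule sublinear_add[OF q xy])

text \<open>A minimal functional below \<open>cone_inf\<close> is additive, hence real linear. On
  \<open>G\<close> it lies below the real part of \<open>\<phi>\<close>, and since \<open>G\<close>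
  contains negatives it equals it. A complex linear functional is determined by its real part, which
  dictates \<open>F x = q x - \<i> q (\<i> x)\<close>.\<close>

theorem Hahn_Banach_complex:
  fixes \<phi> :: "'a \<Rightarrow> complex"
  assumes G: "G \<subseteq> pts X" "vzero X \<in> G" "\<And>x y. x \<in> G \<Longrightarrow> y \<in> G \<Longrightarrow> vadd X x y \<in> G"
      "\<And>a x. x \<in> G \<Longrightarrow> vscale X a x \<in> G"
    and \<phi>: "\<And>x y. x \<in> G \<Longrightarrow> y \<in> G \<Longrightarrow> \<phi> (vadd X x y) = \<phi> x + \<phi> y"
      "\<And>a x. x \<in> G \<Longrightarrow> \<phi> (vscale X a x) = a * \<phi> x"
      "\<And>x. x \<in> G \<Longrightarrow> cmod (\<phi> x) \<le> K * vnorm X x"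
    and K: "0 \<le> K"
  obtains F where "\<And>x y. x \<in> pts X \<Longrightarrow> y \<in> pts X \<Longrightarrow> F (vadd X x y) = F x + F y"
    "\<And>a x. x \<in> pts X \<Longrightarrow> F (vscale X a x) = a * F x"
    "\<And>x. x \<in> pts X \<Longrightarrow> cmod (F x) \<le> K * vnorm X x"
    "\<And>x. x \<in> G \<Longrightarrow> F x = \<phi> x"
proof -
  let ?p = "\<lambda>x. K * vnorm X x" and ?\<phi> = "\<lambda>x. Re (\<phi> x)"
  have p: "sublinear ?p"
    unfolding sublinear_def using K
    by (auto simp: norm_scale distrib_left[symmetric] intro!: mult_left_mono norm_triangle)
  have "cone_dominated ?p G ?\<phi>"
    using G \<phi> by (auto simp: cone_dominated_def intro: order_trans[OF complex_Re_le_cmod])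
  note r = sublinear_cone_inf[OF p this] cone_inf_le[OF p this] cone_inf_upper[OF p this]
  obtain q where q: "sublinear q" "\<And>x. x \<in> pts X \<Longrightarrow> q x \<le> cone_inf ?p G ?\<phi> x"
    "\<And>r x. \<lbrakk>sublinear r; \<And>x. x \<in> pts X \<Longrightarrow> r x \<le> q x; x \<in> pts X\<rbrakk> \<Longrightarrow> r x = q x"
    using ex_minimal_sublinear[OF r(1)] by blast
  have add: "q (vadd X x y) = q x + q y" if "x \<in> pts X" "y \<in> pts X" for x y
    using q(1,3) that by (rule minimal_sublinear_add)
  have neg: "q (vscale X (- 1) x) = - q x" if "x \<in> pts X" for x
    using add[OF that scale_in[OF that], of "-1"] that sublinear_zero[OF q(1)] by (simp add: add_neg)
  have scale: "q (vscale X (of_real t) x) = t * q x" if "x \<in> pts X" for t x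
  proof (cases "0 \<le> t")
    case True
    then show ?thesis using q(1) that by (simp add: sublinear_scale)
  next
    case False
    then have "q (vscale X (of_real (- t)) x) = - t * q x"
      using q(1) that by (intro sublinear_scale) auto
    moreover have "q (vscale X (- 1) (vscale X (of_real t) x)) = - q (vscale X (of_real t) x)"
      using that by (intro neg scale_in)
    ultimately show ?thesis using that by (simp add: scale_scale)
  qed
  have le: "q x \<le> ?p x" if "x \<in> pts X" for x
    using q(2)[OF that] r(2)[OF that] by simp
  have le\<phi>: "q x \<le> ?\<phi> x" if "x \<in> G" for x
  proof -
    have x: "x \<in> pts X" using that G by auto
    \<comment> \<open>This is the candidate \<open>- x\<close> in the infimum: \<open>p\<close>
      vanishes at 0 and \<open>- \<phi> (- x) = \<phi> x\<close>.\<close>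
    have "q x \<le> ?p (vadd X x (vscale X (- 1) x)) - ?\<phi> (vscale X (- 1) x)"
      using order_trans[OF q(2)[OF x] r(3)[OF x G(4)[OF that]]] .
    then show ?thesis
      using x \<phi>(2)[OF that, of "-1"] norm_eq_zero[OF zero_in] by (simp add: add_neg)
  qed
  have eq\<phi>: "q x = ?\<phi> x" if "x \<in> G" for x
  proof -
    have x: "x \<in> pts X" using that G by auto
    have "- q x \<le> - ?\<phi> x"
      using le\<phi>[OF G(4)[OF that], of "-1"] \<phi>(2)[OF that, of "-1"] by (simp add: neg[OF x])
    then show ?thesis using le\<phi>[OF that] by simp
  qed
  define F where "F x = Complex (q x) (- q (vscale X \<i> x))" for x
  have Fadd: "F (vadd X x y) = F x + F y" if "x \<in> pts X" "y \<in> pts X" for x y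
    using that by (simp add: F_def complex_eq_iff add scale_add scale_in)
  have Fscale: "F (vscale X a x) = a * F x" if x: "x \<in> pts X" for a x
  proof -
    have split: "q (vscale X (Complex s t) x) = s * q x + t * q (vscale X \<i> x)" for s t
    proof -
      have "vscale X (Complex s t) x = vadd X (vscale X (of_real s) x) (vscale X (of_real t) (vscale X \<i> x))"
        using x by (simp add: add_scale[symmetric] scale_scale Complex_eq mult.commute)
      then show ?thesis using x by (simp add: add scale scale_in)
    qed
    obtain s t where a: "a = Complex s t" by (cases a)
    \<comment> \<open>The imaginary part of \<open>F (a x)\<close> is \<open>- q (\<i> a x)\<close>,
      so \<open>split\<close> is needed for \<open>\<i> a\<close> as well as for
      \<open>a\<close>.\<close>
    have "\<i> * Complex s t = Complex (- t) s" by (simp add: complex_eq_iff)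
    then show ?thesis
      using x split[of s t] split[of "- t" s] by (simp add: F_def complex_eq_iff[of _ "_ * _"] scale_scale a)
  qed
  show thesis
  proof
    fix x assume x: "x \<in> pts X"
    show "cmod (F x) \<le> K * vnorm X x"
    proof (cases "F x = 0")
      case True
      then show ?thesis using K norm_nonneg[OF x] by simp
    next
      case False
      \<comment> \<open>Rotating \<open>x\<close> by \<open>u\<close> makes \<open>F (u x)\<close>
        real and nonnegative, so the bound on the real part \<open>q\<close> becomes a bound on the
        modulus.\<close>
      define u where "u = cnj (F x) / cmod (F x)"
      have u: "cmod u = 1" using False by (simp add: u_def norm_divide)
      have "u * F x = cmod (F x)"
        using False by (simp add: u_def complex_norm_square[symmetric] power2_eq_square mult.commute)
      then have "F (vscale X u x) = cmod (F x)" using Fscale[OF x] by simp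
      then have "cmod (F x) = q (vscale X u x)"
        by (simp add: F_def complex_eq_iff)
      also have "\<dots> \<le> K * vnorm X x"
        using le[OF scale_in[OF x], of u] u x by (simp add: norm_scale)
      finally show ?thesis .
    qed
  next
    fix x assume "x \<in> G"
    then show "F x = \<phi> x"
      using eq\<phi>[OF \<open>x \<in> G\<close>] eq\<phi>[OF G(4), of x \<i>] \<phi>(2)[of x \<i>] by (simp add: F_def complex_eq_iff)
  qed (use Fadd Fscale in auto)
qed

end

section \<open>Continuous functions on the sphere and orthonormal bases\<close>

abbreviation \<sigma> :: "(real ^ 'n::finite) measure" where "\<sigma> \<equiv> sphere_measure"

lemma finite_measure_sphere: "finite_measure \<sigma>"
  using prob_space_sphere_measure prob_space.finite_measure by blast

text \<open>For a cone measure, the open cone over \<open>U\<close> inside the unit ball has to have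
  positive volume, and it contains a ball around \<open>u / 2\<close>.\<close>

lemma sphere_measure_open_pos:
  fixes U :: "(real ^ 'n::finite) set"
  assumes "open U" "u \<in> U" "norm u = 1"
  shows "0 < emeasure \<sigma> (U \<inter> sphere 0 1)"
proof -
  let ?p = "\<lambda>x :: real ^ 'n. x /\<^sub>R norm x"
  let ?D = "cball (0 :: real ^ 'n) 1"
  let ?O = "ball 0 1 \<inter> ((- {0}) \<inter> ?p -` U)"
  have "open ((- {0}) \<inter> ?p -` U)"
    by (intro continuous_open_preimage continuous_intros assms) auto
  then have "open ?O" by auto
  moreover have "(1/2) *\<^sub>R u \<in> ?O" using assms by auto
  ultimately obtain r where r: "0 < r" "ball ((1/2) *\<^sub>R u) r \<subseteq> ?O"
    unfolding open_contains_ball by blast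
  have "0 < emeasure lborel (ball ((1/2) *\<^sub>R u) r)"
    using r(1) by (simp add: emeasure_ball unit_ball_vol_pos ennreal_zero_less_mult_iff)
  also have "\<dots> \<le> emeasure lborel (?D \<inter> ?p -` (U \<inter> sphere 0 1))"
  proof (rule emeasure_mono)
    have "?O \<subseteq> ?D \<inter> ?p -` (U \<inter> sphere 0 1)" by (auto simp: norm_inverse)
    with r(2) show "ball ((1/2) *\<^sub>R u) r \<subseteq> ?D \<inter> ?p -` (U \<inter> sphere 0 1)" by (rule order_trans)
    have "?p -` (U \<inter> sphere 0 1) \<in> sets borel"
      using measurable_sets[of ?p borel borel "U \<inter> sphere 0 1"] assms(1) by simp
    then show "?D \<inter> ?p -` (U \<inter> sphere 0 1) \<in> sets lborel" by auto
  qed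
  finally have pos: "0 < emeasure lborel (?D \<inter> ?p -` (U \<inter> sphere 0 1))" .
  have "emeasure lborel ?D \<noteq> \<infinity>"
    using emeasure_bounded_finite[of ?D] by auto
  moreover have "U \<inter> sphere 0 1 \<in> sets \<sigma>"
    using assms(1) by (auto simp: sets_sphere_measure sets_restrict_space)
  ultimately show ?thesis
    using pos by (simp add: emeasure_sphere_measure ennreal_zero_less_divide top.not_eq_extremum)
qed

lemma continuous_on_sphere_measurable:
  "continuous_on (sphere 0 1) f \<Longrightarrow> (f :: _ \<Rightarrow> 'b::topological_space) \<in> borel_measurable \<sigma>"
  using borel_measurable_continuous_on_restrict[of "sphere 0 1" f]
  by (simp cong: measurable_cong_sets add: sets_sphere_measure)

lemma integrable_sphere_continuous:
  fixes f :: "real ^ 'n::finite \<Rightarrow> 'b::{banach, second_countable_topology}"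
  assumes "continuous_on (sphere 0 1) f"
  shows "integrable \<sigma> f"
proof -
  interpret finite_measure "\<sigma> :: (real ^ 'n) measure" by (rule finite_measure_sphere)
  have "bounded (f ` sphere 0 1)"
    using assms by (intro compact_imp_bounded compact_continuous_image) auto
  then obtain K where "\<And>x. x \<in> sphere 0 1 \<Longrightarrow> norm (f x) \<le> K"
    unfolding bounded_iff by blast
  then show ?thesis
    using continuous_on_sphere_measurable[OF assms]
    by (intro integrable_const_bound[where B = K]) (auto simp: space_sphere_measure)
qed

lemma orthogonal_transformation_sphere:
  "orthogonal_transformation T \<Longrightarrow> norm x = 1 \<Longrightarrow> norm (T x) = 1"
  by (simp add: orthogonal_transformation_norm)

lemma orthogonal_transformation_continuous:
  fixes T :: "real ^ 'n \<Rightarrow> real ^ 'n"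
  shows "orthogonal_transformation T \<Longrightarrow> continuous_on A T"
  by (intro linear_continuous_on) (simp add: orthogonal_transformation_def linear_conv_bounded_linear)

lemma measurable_rotation:
  fixes T :: "real ^ 'n \<Rightarrow> real ^ 'n"
  assumes "orthogonal_transformation T"
  shows "T \<in> \<sigma> \<rightarrow>\<^sub>M \<sigma>"
proof -
  have "T \<in> restrict_space borel (sphere 0 1) \<rightarrow>\<^sub>M restrict_space borel (sphere 0 1)"
    using assms borel_measurable_continuous_on_restrict[OF orthogonal_transformation_continuous[OF assms]]
    by (intro measurable_restrict_space2)
      (auto simp: space_restrict_space orthogonal_transformation_sphere)
  then show ?thesis by (simp cong: measurable_cong_sets add: sets_sphere_measure)
qed

lemma distr_rotation:
  fixes T :: "real ^ 'n::{finite, wellorder} \<Rightarrow> real ^ 'n::{finite, wellorder}"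
  assumes T: "orthogonal_transformation T"
  shows "distr \<sigma> \<sigma> T = \<sigma>"
proof (rule measure_eqI)
  fix A assume "A \<in> sets (distr \<sigma> \<sigma> T)"
  then have A: "A \<in> sets \<sigma>" by simp
  let ?B = "T -` A \<inter> space \<sigma>"
  have B: "?B \<in> sets \<sigma>" using measurable_rotation[OF T] A by (rule measurable_sets)
  have "T ` ?B = A"
  proof -
    have "A \<subseteq> sphere 0 1" using sets.sets_into_space[OF A] by (simp add: space_sphere_measure)
    moreover have "\<exists>x. T x = y" for y
      using orthogonal_transformation_surj[OF T] by (metis surjD)
    ultimately show ?thesis
      using orthogonal_transformation_norm[OF T] by (force simp: space_sphere_measure)
  qed
  then show "emeasure (distr \<sigma> \<sigma> T) A = emeasure \<sigma> A"
    using sphere_measure_rotation_invariant[OF T B] A measurable_rotation[OF T]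
    by (simp add: emeasure_distr)
qed simp

abbreviation CS :: "'n::finite cfun set" where "CS \<equiv> pts C_sphere"

lemma sum_fun_apply: "(\<Sum>i\<in>A. f i) x = (\<Sum>i\<in>A. f i x)" for f :: "'i \<Rightarrow> 'a \<Rightarrow> 'b::comm_monoid_add"
  by (induction A rule: infinite_finite_induct) auto

lemma CS_continuous: "f \<in> CS \<Longrightarrow> continuous_on (sphere 0 1) f"
  and CS_outside: "f \<in> CS \<Longrightarrow> norm x \<noteq> 1 \<Longrightarrow> f x = 0"
  by (auto simp: C_sphere_def)

lemma CS_I: "continuous_on (sphere 0 1) f \<Longrightarrow> (\<And>x. norm x \<noteq> 1 \<Longrightarrow> f x = 0) \<Longrightarrow> f \<in> CS"
  by (auto simp: C_sphere_def)

lemma subspace_CS: "cfun.subspace (CS :: 'n::finite cfun set)"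
  by (auto simp: cfun.subspace_def C_sphere_def intro!: continuous_intros)

lemma CS_rotate:
  fixes f :: "'n::finite cfun" and T :: "real ^ 'n \<Rightarrow> real ^ 'n"
  assumes f: "f \<in> CS" and T: "orthogonal_transformation T"
  shows "f \<circ> T \<in> CS"
proof (rule CS_I)
  show "continuous_on (sphere 0 1) (f \<circ> T)"
    using T by (intro continuous_on_compose orthogonal_transformation_continuous
        continuous_on_subset[OF CS_continuous[OF f]])
      (auto simp: orthogonal_transformation_sphere)
  show "(f \<circ> T) x = 0" if "norm x \<noteq> 1" for x
    using that T CS_outside[OF f] by (simp add: orthogonal_transformation_norm)
qed

lemma integrable_CS: "f \<in> CS \<Longrightarrow> integrable \<sigma> f"
  by (simp add: CS_continuous integrable_sphere_continuous)

lemma integrable_inner_CS: "f \<in> CS \<Longrightarrow> g \<in> CS \<Longrightarrow> integrable \<sigma> (\<lambda>y. f y * cnj (g y))"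
  by (intro integrable_sphere_continuous continuous_intros CS_continuous)

lemma integrable_indicator_mult:
  fixes g :: "real ^ 'n::finite \<Rightarrow> complex"
  assumes "A \<in> sets \<sigma>" "integrable \<sigma> g"
  shows "integrable \<sigma> (\<lambda>t. indicator A t * g t)"
proof -
  have "(\<lambda>t. indicator A t * g t) = (\<lambda>t. indicator A t *\<^sub>R g t)" by (auto simp: indicator_def)
  then show ?thesis using integrable_mult_indicator[OF assms] by simp
qed

section \<open>The inner product on continuous functions and orthonormal bases\<close>

lemma l2_inner_add_left:
  "\<lbrakk>f \<in> CS; g \<in> CS; h \<in> CS\<rbrakk> \<Longrightarrow> l2_inner (f + g) h = l2_inner f h + l2_inner g h"
  by (simp add: l2_inner_def distrib_right integrable_inner_CS)

lemma l2_inner_diff_left: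
  "\<lbrakk>f \<in> CS; g \<in> CS; h \<in> CS\<rbrakk> \<Longrightarrow> l2_inner (\<lambda>x. f x - g x) h = l2_inner f h - l2_inner g h"
  by (simp add: l2_inner_def left_diff_distrib integrable_inner_CS)

lemma l2_inner_scale_left: "l2_inner (\<lambda>x. c * f x) h = c * l2_inner f h"
  by (simp add: l2_inner_def mult.assoc)

lemma l2_inner_scale_right: "l2_inner f (\<lambda>x. c * h x) = cnj c * l2_inner f h"
  by (simp add: l2_inner_def mult.left_commute[of _ "cnj c"])

lemma l2_inner_cnj: "cnj (l2_inner f g) = l2_inner g f"
  unfolding l2_inner_def by (subst Bochner_Integration.integral_cnj[symmetric]) (simp add: mult.commute)

lemma l2_inner_sum_left:
  fixes B :: "'n::finite cfun set"
  assumes "finite B" "B \<subseteq> CS" "h \<in> CS"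
  shows "l2_inner (\<lambda>x. \<Sum>b\<in>B. u b * b x) h = (\<Sum>b\<in>B. u b * l2_inner b h)"
proof -
  have "integrable \<sigma> (\<lambda>y. u b * b y * cnj (h y))" if "b \<in> B" for b
    using integrable_inner_CS[of b h] assms that by (auto simp: mult.assoc)
  then show ?thesis
    by (simp add: l2_inner_def sum_distrib_right mult.assoc)
qed

lemma l2_inner_self: "l2_inner f f = complex_of_real (LINT y|\<sigma>. (cmod (f y))\<^sup>2)"
  unfolding l2_inner_def integral_complex_of_real[symmetric]
  by (simp add: complex_norm_square del: of_real_power)

text \<open>The integral only gives \<open>f = 0\<close> almost everywhere. By continuity the set
  where \<open>f\<close> does not vanish is relatively open, and a nonempty such set has positive
  measure.\<close>

lemma l2_inner_self_eq_0:
  fixes f :: "'n::finite cfun"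
  assumes f: "f \<in> CS" and z: "l2_inner f f = 0"
  shows "f = (\<lambda>x. 0)"
proof (rule ccontr)
  assume "f \<noteq> (\<lambda>x. 0)"
  then obtain u where u: "f u \<noteq> 0" by auto
  then have nu: "norm u = 1" using CS_outside[OF f] by auto
  have "(LINT y|\<sigma>. (cmod (f y))\<^sup>2) = 0" using z by (simp add: l2_inner_self)
  moreover have "integrable \<sigma> (\<lambda>y. (cmod (f y))\<^sup>2)"
    by (rule integrable_sphere_continuous) (intro continuous_intros CS_continuous f)
  ultimately have "AE y in \<sigma>. (cmod (f y))\<^sup>2 = 0"
    using integral_nonneg_eq_0_iff_AE[of \<sigma> "\<lambda>y. (cmod (f y))\<^sup>2"] by simp
  then have ae: "AE y in \<sigma>. f y = 0" by simp
  have "openin (top_of_set (sphere 0 1)) (sphere 0 1 \<inter> f -` (- {0}))"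
    using CS_continuous[OF f] by (intro continuous_openin_preimage_gen) auto
  then obtain U where U: "open U" "sphere 0 1 \<inter> f -` (- {0}) = sphere 0 1 \<inter> U"
    unfolding openin_open by blast
  have "u \<in> sphere 0 1 \<inter> f -` (- {0})" using u nu by simp
  then have "u \<in> U" unfolding U(2) by simp
  then have "0 < emeasure \<sigma> (U \<inter> sphere 0 1)"
    using U(1) nu by (intro sphere_measure_open_pos)
  moreover have "U \<inter> sphere 0 1 = {y \<in> space \<sigma>. \<not> f y = 0}"
    unfolding Int_commute[of U] U(2)[symmetric] by (auto simp: space_sphere_measure)
  moreover have "U \<inter> sphere 0 1 \<in> sets \<sigma>"
    using U(1) by (auto simp: sets_sphere_measure sets_restrict_space)
  ultimately show False
    using ae by (simp add: AE_iff_measurable[OF _ refl])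
qed

text \<open>Gram--Schmidt by induction on a finite spanning set, which may be dependent: if the
  residual \<open>w\<close> of the new vector vanishes, the old basis is kept, and otherwise
  \<open>w\<close> is normalized and added.\<close>

lemma ex_orthonormal_span:
  fixes B :: "'n::finite cfun set"
  assumes "finite B" "B \<subseteq> CS"
  shows "\<exists>B'. orthonormal_basis (cfun.span B) B'"
  using assms
proof (induction B)
  case empty
  then show ?case by (intro exI[of _ "{}"]) (simp add: orthonormal_basis_def)
next
  case (insert a B)
  then obtain B' where B': "finite B'" "cfun.span B' = cfun.span B"
      "\<And>f g. f \<in> B' \<Longrightarrow> g \<in> B' \<Longrightarrow> l2_inner f g = (if f = g then 1 else 0)"
    by (auto simp: orthonormal_basis_def)
  have sub: "B' \<subseteq> CS"
    using B'(2) cfun.span_superset[of B'] cfun.span_minimal[OF _ subspace_CS] insert.prems by blast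
  have a: "a \<in> CS" using insert.prems by simp
  define p where "p = (\<lambda>x. \<Sum>b\<in>B'. l2_inner a b * b x)"
  have p: "p \<in> cfun.span B"
  proof -
    have "(\<Sum>b\<in>B'. (\<lambda>x. l2_inner a b * b x)) \<in> cfun.span B'"
      by (intro cfun.span_sum cfun.span_scale cfun.span_base)
    also have "(\<Sum>b\<in>B'. (\<lambda>x. l2_inner a b * b x)) = p"
      by (auto simp: p_def sum_fun_apply)
    finally show ?thesis using B'(2) by simp
  qed
  have pC: "p \<in> CS"
    using p cfun.span_minimal[OF _ subspace_CS, of B] insert.prems by auto
  define w where "w = (\<lambda>x. a x - p x)"
  have wC: "w \<in> CS"
    using cfun.subspace_diff[OF subspace_CS a pC] by (simp add: w_def fun_diff_def)
  have orth: "l2_inner w b = 0" if "b \<in> B'" for b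
  proof -
    have "l2_inner p b = (\<Sum>c\<in>B'. l2_inner a c * l2_inner c b)"
      unfolding p_def using B'(1) sub that by (intro l2_inner_sum_left) auto
    also have "\<dots> = (\<Sum>c\<in>B'. if c = b then l2_inner a b else 0)"
      using that by (intro sum.cong) (auto simp: B'(3))
    also have "\<dots> = l2_inner a b" using that B'(1) by simp
    finally show ?thesis
      unfolding w_def using that sub a pC by (subst l2_inner_diff_left) auto
  qed
  have aw: "a = p + w" by (auto simp: w_def)
  show ?case
  proof (cases "w = (\<lambda>x. 0)")
    case True
    then have "a \<in> cfun.span B" using p aw by (simp add: plus_fun_def)
    then show ?thesis using B' by (auto simp: orthonormal_basis_def cfun.span_redundant)
  next
    case False
    define r where "r = (LINT y|\<sigma>. (cmod (w y))\<^sup>2)"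
    have rw: "l2_inner w w = complex_of_real r" by (simp add: l2_inner_self r_def)
    have "0 \<le> r" by (simp add: r_def)
    then have r: "0 < r"
      using l2_inner_self_eq_0[OF wC] False rw by (cases "r = 0") auto
    define k where "k = complex_of_real (1 / sqrt r)"
    define b where "b = (\<lambda>x. k * w x)"
    have bC: "b \<in> CS" using cfun.subspace_scale[OF subspace_CS wC, of k] by (simp add: b_def)
    have bb: "l2_inner b b = 1"
    proof -
      have "l2_inner b b = k * cnj k * l2_inner w w"
        by (simp add: b_def l2_inner_scale_left l2_inner_scale_right)
      also have "\<dots> = 1"
        unfolding rw k_def using r by (simp flip: of_real_mult of_real_divide)
      finally show ?thesis .
    qed
    have bo: "l2_inner b c = 0" "l2_inner c b = 0" if "c \<in> B'" for c
      using orth[OF that] l2_inner_cnj[of b c] by (simp_all add: b_def l2_inner_scale_left)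
    have bw: "w = (\<lambda>x. (1 / k) * b x)" using r by (auto simp: b_def k_def)
    have "cfun.span (insert b B') = cfun.span (insert a B)"
      unfolding cfun.span_eq
    proof safe
      have "w \<in> cfun.span (insert a B)"
        using cfun.span_diff[of a "insert a B" p] p cfun.span_mono[of B "insert a B"] cfun.span_base[of a "insert a B"]
        by (auto simp: w_def fun_diff_def)
      then show "b \<in> cfun.span (insert a B)" unfolding b_def by (rule cfun.span_scale)
      show "x \<in> cfun.span (insert a B)" if "x \<in> B'" for x
        using cfun.span_base[OF that] B'(2) cfun.span_mono[of B "insert a B"] by auto
      have "w \<in> cfun.span (insert b B')"
        by (subst bw) (intro cfun.span_scale cfun.span_base, simp)
      moreover have "p \<in> cfun.span (insert b B')"
        using p B'(2) cfun.span_mono[of B' "insert b B'"] by auto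
      ultimately show "a \<in> cfun.span (insert b B')" unfolding aw by (intro cfun.span_add)
      show "x \<in> cfun.span (insert b B')" if "x \<in> B" for x
        using cfun.span_base[OF that] B'(2) cfun.span_mono[of B' "insert b B'"] by auto
    qed
    moreover have "b \<notin> B'" using bb bo(1) by force
    ultimately show ?thesis
      using B' bb bo unfolding orthonormal_basis_def by (intro exI[of _ "insert b B'"]) force
  qed
qed

lemma ex_orthonormal_basis:
  assumes "finite_dim_subspace S"
  shows "\<exists>B. orthonormal_basis S B"
proof -
  obtain B where B: "finite B" "cfun.span B = S" "S \<subseteq> CS"
    using assms by (auto simp: finite_dim_subspace_def)
  then have "B \<subseteq> CS" using cfun.span_superset[of B] by auto
  then show ?thesis using ex_orthonormal_span[OF B(1)] B(2) by simp
qed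

context
  fixes S B :: "'n::finite cfun set"
  assumes SC: "S \<subseteq> CS" and ob: "orthonormal_basis S B"
begin

lemma orthonormal_basis_finite: "finite B"
  and orthonormal_basis_inner: "f \<in> B \<Longrightarrow> g \<in> B \<Longrightarrow> l2_inner f g = (if f = g then 1 else 0)"
  using ob by (auto simp: orthonormal_basis_def)

lemma orthonormal_basis_sub: "B \<subseteq> S"
  using ob cfun.span_superset[of B] by (auto simp: orthonormal_basis_def)

lemma orthonormal_basis_CS: "b \<in> B \<Longrightarrow> b \<in> CS"
  using orthonormal_basis_sub SC by auto

lemma orthonormal_basis_comb: "(\<lambda>x. \<Sum>b\<in>B. u b * b x) \<in> S"
proof -
  have "(\<Sum>b\<in>B. (\<lambda>x. u b * b x)) \<in> cfun.span B"
    by (intro cfun.span_sum cfun.span_scale cfun.span_base)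
  also have "(\<Sum>b\<in>B. (\<lambda>x. u b * b x)) = (\<lambda>x. \<Sum>b\<in>B. u b * b x)"
    by (auto simp: sum_fun_apply)
  finally show ?thesis using ob by (simp add: orthonormal_basis_def)
qed

lemma inner_orthonormal_comb:
  assumes "b \<in> B" shows "l2_inner (\<lambda>x. \<Sum>b\<in>B. u b * b x) b = u b"
proof -
  have "l2_inner (\<lambda>x. \<Sum>b\<in>B. u b * b x) b = (\<Sum>c\<in>B. u c * l2_inner c b)"
    using assms SC orthonormal_basis_sub by (intro l2_inner_sum_left orthonormal_basis_finite) auto
  also have "\<dots> = (\<Sum>c\<in>B. if c = b then u b else 0)"
    using assms by (intro sum.cong) (auto simp: orthonormal_basis_inner)
  finally show ?thesis using assms orthonormal_basis_finite by simp
qed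

lemma orthonormal_expansion:
  assumes "f \<in> S" shows "f x = (\<Sum>b\<in>B. l2_inner f b * b x)"
proof -
  have "f \<in> cfun.span B" using assms ob by (simp add: orthonormal_basis_def)
  then obtain u where "f = (\<Sum>b\<in>B. (\<lambda>x. u b * b x))"
    unfolding cfun.span_finite[OF orthonormal_basis_finite] by blast
  then have u: "f = (\<lambda>x. \<Sum>b\<in>B. u b * b x)" by (auto simp: sum_fun_apply)
  show ?thesis
    by (subst u, intro sum.cong) (simp_all add: u inner_orthonormal_comb)
qed

text \<open>The Fourier sum has a residual orthogonal to each \<open>b\<close>, hence to
  \<open>S\<close>. Any other solution in \<open>S\<close> has the same inner products with the
  basis elements and thus the same expansion, so the description is unique.\<close>

lemma l2_proj_eq:
  assumes f: "f \<in> CS" shows "l2_proj S f = (\<lambda>x. \<Sum>b\<in>B. l2_inner f b * b x)"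
  unfolding l2_proj_def
proof (rule the_equality, intro conjI ballI)
  let ?g = "\<lambda>x. \<Sum>b\<in>B. l2_inner f b * b x"
  show gS: "?g \<in> S" by (rule orthonormal_basis_comb)
  then have gC: "?g \<in> CS" using SC by auto
  have *: "l2_inner (\<lambda>x. f x - ?g x) b = 0" if "b \<in> B" for b
    using that f gC orthonormal_basis_CS[OF that] by (simp add: l2_inner_diff_left inner_orthonormal_comb)
  show 1: "l2_inner (\<lambda>x. f x - ?g x) h = 0" if "h \<in> S" for h
  proof -
    have h: "h = (\<lambda>x. \<Sum>b\<in>B. l2_inner h b * b x)" using orthonormal_expansion[OF that] by auto
    have "cnj (l2_inner (\<lambda>x. f x - ?g x) h) = l2_inner h (\<lambda>x. f x - ?g x)"
      by (rule l2_inner_cnj)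
    also have "\<dots> = (\<Sum>b\<in>B. l2_inner h b * l2_inner b (\<lambda>x. f x - ?g x))"
      by (subst h, rule l2_inner_sum_left)
        (use orthonormal_basis_finite orthonormal_basis_CS cfun.subspace_diff[OF subspace_CS f gC]
          in \<open>auto simp: fun_diff_def\<close>)
    also have "\<dots> = 0"
      by (rule sum.neutral) (use * in \<open>simp add: l2_inner_cnj[of "\<lambda>x. f x - ?g x", symmetric]\<close>)
    finally show ?thesis by simp
  qed
  fix g assume g: "g \<in> S \<and> (\<forall>h\<in>S. l2_inner (\<lambda>x. f x - g x) h = 0)"
  then have gC': "g \<in> CS" using SC by auto
  have "l2_inner g b = l2_inner f b" if "b \<in> B" for b
    using g that orthonormal_basis_sub l2_inner_diff_left[OF f gC' orthonormal_basis_CS[OF that]] by auto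
  then show "g = ?g"
    using orthonormal_expansion[of g] g by auto
qed

end

section \<open>Haar measure on the orthogonal group\<close>

type_synonym 'n mat = "real ^ 'n ^ 'n"
type_synonym 'n tuple = "'n \<Rightarrow> real ^ 'n"

text \<open>The recursion follows the wellorder of the index type, so that a frame of
  \<open>real ^ 'n\<close> is indexed like the coordinates. Since the inverse of 0 is 0, a vanishing
  remainder \<open>w\<close> yields the value 0, which serves as the mark of a degenerate
  tuple.\<close>

function gram_schmidt :: "('n::{finite, wellorder} \<Rightarrow> 'a::real_inner) \<Rightarrow> 'n \<Rightarrow> 'a" where
  "gram_schmidt v k =
     (let w = v k - (\<Sum>j\<in>{..<k}. (v k \<bullet> gram_schmidt v j) *\<^sub>R gram_schmidt v j)
      in w /\<^sub>R norm w)"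
  by auto
termination
  by (relation "inv_image {(x, y). x < y} snd") (auto intro: wf_inv_image wf)

declare gram_schmidt.simps [simp del]

text \<open>Inner products, linear combinations and norms are all that the recursion uses, and
  \<open>U\<close> respects them. The invariance of the law of the frame rests on this.\<close>

lemma gram_schmidt_rotate:
  fixes U :: "'a::real_inner \<Rightarrow> 'a"
  assumes U: "orthogonal_transformation U"
  shows "gram_schmidt (\<lambda>i. U (v i)) k = U (gram_schmidt v k)"
proof (induction k rule: less_induct)
  case (less k)
  have l: "linear U" and i: "U x \<bullet> U y = x \<bullet> y" for x y
    using U by (auto simp: orthogonal_transformation_def)
  let ?w = "v k - (\<Sum>j\<in>{..<k}. (v k \<bullet> gram_schmidt v j) *\<^sub>R gram_schmidt v j)"
  have "U (v k) - (\<Sum>j\<in>{..<k}. (U (v k) \<bullet> gram_schmidt (\<lambda>i. U (v i)) j) *\<^sub>R gram_schmidt (\<lambda>i. U (v i)) j)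
      = U ?w"
    using less by (simp add: i linear_diff[OF l] linear_sum[OF l] linear_cmul[OF l])
  then show ?case
    using U by (subst (1 2) gram_schmidt.simps) (simp add: Let_def linear_cmul[OF l] orthogonal_transformation_norm)
qed

lemma gram_schmidt_norm: "gram_schmidt v k \<noteq> 0 \<Longrightarrow> norm (gram_schmidt v k) = 1"
  by (subst (asm) gram_schmidt.simps, subst gram_schmidt.simps) (auto simp: Let_def)

lemma gram_schmidt_orthogonal:
  assumes nz: "\<And>j. gram_schmidt v j \<noteq> 0"
  shows "i < k \<Longrightarrow> gram_schmidt v k \<bullet> gram_schmidt v i = 0"
proof (induction k arbitrary: i rule: less_induct)
  case (less k)
  let ?g = "gram_schmidt v"
  have o: "?g j \<bullet> ?g i = (if j = i then 1 else 0)" if "j < k" for j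
  proof (cases j i rule: linorder_cases)
    case less': less
    then show ?thesis using less.IH[of i j] less.prems by (simp add: inner_commute)
  next
    case equal
    then show ?thesis using gram_schmidt_norm[OF nz, of i] by (simp add: norm_eq_1)
  next
    case greater
    then show ?thesis using less.IH[of j i] that by simp
  qed
  have "(\<Sum>j\<in>{..<k}. (v k \<bullet> ?g j) *\<^sub>R ?g j) \<bullet> ?g i = (\<Sum>j\<in>{..<k}. if j = i then v k \<bullet> ?g i else 0)"
    unfolding inner_sum_left by (intro sum.cong) (auto simp: o)
  also have "\<dots> = v k \<bullet> ?g i" using less.prems by simp
  finally show ?case
    by (subst gram_schmidt.simps) (simp add: Let_def inner_diff_left)
qed

lemma gram_schmidt_span: "gram_schmidt v k \<in> span (v ` {..k})"
proof (induction k rule: less_induct)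
  case (less k)
  have "gram_schmidt v j \<in> span (v ` {..k})" if "j < k" for j
    using less[OF that] span_mono[OF image_mono, of "{..j}" "{..k}" v] that
    by (meson atMost_iff less_imp_le order_trans subset_iff)
  then show ?case
    by (subst gram_schmidt.simps)
      (auto simp: Let_def intro!: span_scale span_diff span_sum intro: span_base)
qed

lemma gram_schmidt_zero:
  assumes "gram_schmidt v k = 0"
  shows "v k \<in> span (v ` {..<k})"
proof -
  have "gram_schmidt v j \<in> span (v ` {..<k})" if "j < k" for j
    using gram_schmidt_span[of v j] span_mono[OF image_mono, of "{..j}" "{..<k}" v] that
    by (meson atMost_iff lessThan_iff order_le_less_trans subset_iff)
  then have "(\<Sum>j\<in>{..<k}. (v k \<bullet> gram_schmidt v j) *\<^sub>R gram_schmidt v j) \<in> span (v ` {..<k})"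
    by (intro span_sum span_scale) auto
  moreover have "v k = (\<Sum>j\<in>{..<k}. (v k \<bullet> gram_schmidt v j) *\<^sub>R gram_schmidt v j)"
    using assms by (subst (asm) gram_schmidt.simps) (auto simp: Let_def)
  ultimately show ?thesis by simp
qed

text \<open>The linear map \<open>L\<close> with \<open>L e\<^sub>j = v\<^sub>j\<close> is
  injective: if \<open>L x = 0\<close> and \<open>x\<close> is nonzero, then the norm of
  \<open>x = \<Sum> x\<^sub>j (e\<^sub>j - v\<^sub>j)\<close> is less than itself, each of the
  \<open>CARD('n)\<close> terms contributing at most a share \<open>1 / CARD('n)\<close> and one
  with \<open>x\<^sub>i \<noteq> 0\<close> strictly less. A zero at \<open>k\<close> would put
  \<open>v\<^sub>k\<close> in the span of its predecessors, hence \<open>e\<^sub>k\<close> in the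
  span of the earlier basis vectors.\<close>

lemma gram_schmidt_near_basis:
  fixes v :: "'n::{finite, wellorder} \<Rightarrow> real ^ 'n::{finite, wellorder}"
  assumes near: "\<And>j. norm (v j - axis j 1) < 1 / CARD('n)"
  shows "gram_schmidt v k \<noteq> 0"
proof
  assume "gram_schmidt v k = 0"
  then have vk: "v k \<in> span (v ` {..<k})" by (rule gram_schmidt_zero)
  define L where "L x = (\<Sum>j\<in>UNIV. (x $ j) *\<^sub>R v j)" for x
  have L: "linear L"
    by (intro linearI) (auto simp: L_def scaleR_add_left sum.distrib scaleR_sum_right)
  have La: "L (axis j 1) = v j" for j
  proof -
    have "L (axis j 1) = (\<Sum>i\<in>UNIV. if i = j then v j else 0)"
      unfolding L_def by (intro sum.cong) (auto simp: axis_def)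
    then show ?thesis by simp
  qed
  have "x = 0" if "L x = 0" for x
  proof (rule ccontr)
    assume "x \<noteq> 0"
    then obtain i where i: "x $ i \<noteq> 0" by (auto simp: vec_eq_iff)
    have "x = (\<Sum>j\<in>UNIV. (x $ j) *\<^sub>R axis j 1)"
      by (simp add: basis_expansion scalar_mult_eq_scaleR[symmetric])
    then have "x = (\<Sum>j\<in>UNIV. (x $ j) *\<^sub>R (axis j 1 - v j))"
      using that by (simp add: L_def scaleR_diff_right sum_subtractf)
    then have "norm x \<le> (\<Sum>j\<in>UNIV. norm ((x $ j) *\<^sub>R (axis j 1 - v j)))"
      by (metis norm_sum)
    also have "\<dots> < (\<Sum>j\<in>(UNIV::'n set). norm x * (1 / CARD('n)))"
    proof (rule sum_strict_mono_ex1)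
      show "\<forall>j\<in>UNIV. norm ((x $ j) *\<^sub>R (axis j 1 - v j)) \<le> norm x * (1 / CARD('n))"
        using near component_le_norm_cart[of x]
        by (auto intro!: mult_mono simp: norm_minus_commute[of "axis _ _"] intro: less_imp_le simp del: mult_1_right times_divide_eq_right)
      have "norm ((x $ i) *\<^sub>R (axis i 1 - v i)) < \<bar>x $ i\<bar> * (1 / CARD('n))"
        using near[of i] i by (simp add: norm_minus_commute[of "axis _ _"] del: times_divide_eq_right mult_1_right)
      also have "\<dots> \<le> norm x * (1 / CARD('n))"
        using component_le_norm_cart[of x i] by (intro mult_right_mono) auto
      finally show "\<exists>j\<in>UNIV. norm ((x $ j) *\<^sub>R (axis j 1 - v j)) < norm x * (1 / CARD('n))" by blast
    qed simp
    finally show False by simp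
  qed
  then have inj: "inj L" using L by (simp add: linear_injective_0)
  have "span (v ` {..<k}) = L ` span ((\<lambda>j. axis j 1) ` {..<k})"
    by (simp add: linear_span_image[OF L, symmetric] image_image La)
  with vk obtain y where y: "y \<in> span ((\<lambda>j. axis j 1) ` {..<k})" "L (axis k 1) = L y"
    by (auto simp: La)
  have "subspace {y :: real ^ 'n::{finite, wellorder}. y $ k = 0}" by (auto simp: subspace_def)
  then have "span ((\<lambda>j. axis j 1) ` {..<k}) \<subseteq> {y :: real ^ 'n::{finite, wellorder}. y $ k = 0}"
    by (intro span_minimal) (auto simp: axis_def)
  then have "y $ k = 0" using y(1) by auto
  moreover have "y = axis k 1" using inj y(2) by (simp add: inj_eq)
  ultimately show False by (simp add: axis_def)
qed

section \<open>Random frames and their law\<close>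

abbreviation sphere_tuples :: "'n::{finite, wellorder} tuple measure" where
  "sphere_tuples \<equiv> \<Pi>\<^sub>M i\<in>UNIV. \<sigma>"

text \<open>
  Generic tuples in fact have full measure, but since they form an invariant set it is enough to
  condition on them, and for this any positive measure suffices.
\<close>

definition generic_tuples :: "'n::{finite, wellorder} tuple set" where
  "generic_tuples = {v \<in> space sphere_tuples. \<forall>k. gram_schmidt v k \<noteq> 0}"

text \<open>The vectors are the columns, so that rotating the tuple multiplies the matrix from the
  left.\<close>

definition frame :: "'n::{finite, wellorder} tuple \<Rightarrow> 'n mat" where
  "frame v = (\<chi> i j. gram_schmidt v j $ i)"

lemma id_measurable_sphere: "(\<lambda>x. x) \<in> \<sigma> \<rightarrow>\<^sub>M borel"
  using measurable_ident[of borel] measurable_restrict_space1[of "\<lambda>x. x" borel borel]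
  by (simp cong: measurable_cong_sets add: sets_sphere_measure id_def)

lemma gram_schmidt_measurable:
  "(\<lambda>v. gram_schmidt v k) \<in> sphere_tuples \<rightarrow>\<^sub>M borel"
proof (induction k rule: less_induct)
  case (less k)
  have [measurable]: "(\<lambda>v. v k) \<in> sphere_tuples \<rightarrow>\<^sub>M borel"
    by (rule measurable_compose[OF measurable_component_singleton[of k UNIV "\<lambda>_. \<sigma>"] id_measurable_sphere]) simp
  have "(\<lambda>v. \<Sum>j\<in>{..<k}. (v k \<bullet> gram_schmidt v j) *\<^sub>R gram_schmidt v j) \<in> sphere_tuples \<rightarrow>\<^sub>M borel"
    using less by (intro borel_measurable_sum borel_measurable_scaleR borel_measurable_inner) auto
  then show ?case
    by (subst gram_schmidt.simps) (simp add: Let_def)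
qed

lemma frame_measurable: "frame \<in> sphere_tuples \<rightarrow>\<^sub>M borel"
proof (subst borel_measurable_euclidean_space, rule ballI)
  fix b :: "'n::{finite, wellorder} mat" assume "b \<in> Basis"
  then obtain i j where "b = axis i (axis j 1)" by (auto simp: Basis_vec_def)
  then have "(\<lambda>v. frame v \<bullet> b) = (\<lambda>v. gram_schmidt v j \<bullet> axis i 1)"
    by (simp add: frame_def inner_axis)
  then show "(\<lambda>v. frame v \<bullet> b) \<in> borel_measurable sphere_tuples"
    by (auto intro: borel_measurable_inner gram_schmidt_measurable)
qed

lemma generic_tuples_sets: "generic_tuples \<in> sets sphere_tuples"
proof -
  have [measurable]: "(\<lambda>v. gram_schmidt v k) \<in> sphere_tuples \<rightarrow>\<^sub>M borel" for k
    by (rule gram_schmidt_measurable)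
  show ?thesis unfolding generic_tuples_def by measurable
qed

lemma prob_space_sphere_tuples: "prob_space sphere_tuples"
  by (intro prob_space_PiM prob_space_sphere_measure)

text \<open>A product of small caps around the basis vectors consists of generic tuples, and each
  cap has positive measure.\<close>

lemma generic_tuples_pos:
  "emeasure sphere_tuples (generic_tuples :: ('n::{finite, wellorder} \<Rightarrow> _) set) \<noteq> 0"
proof -
  let ?A = "\<lambda>j::'n. ball (axis j 1) (1 / CARD('n)) \<inter> sphere 0 1 :: (real ^ 'n::{finite, wellorder}) set"
  interpret product_prob_space "\<lambda>_::'n. \<sigma> :: (real ^ 'n::{finite, wellorder}) measure" UNIV
    by (intro product_prob_spaceI prob_space_sphere_measure)
  have A: "?A j \<in> sets \<sigma>" for j
    by (auto simp: sets_sphere_measure sets_restrict_space)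
  have "emeasure \<sigma> (?A j) \<noteq> 0" for j
    using sphere_measure_open_pos[of "ball (axis j 1) (1 / CARD('n))" "axis j 1"] by auto
  then have "emeasure sphere_tuples (Pi\<^sub>E UNIV ?A) \<noteq> 0"
    using A by (subst emeasure_PiM) (auto simp: prod_zero_iff)
  moreover have "Pi\<^sub>E UNIV ?A \<subseteq> generic_tuples"
  proof
    fix v assume v: "v \<in> Pi\<^sub>E UNIV ?A"
    have "gram_schmidt v k \<noteq> 0" for k
      using v by (intro gram_schmidt_near_basis) (auto simp: PiE_def Pi_def dist_norm norm_minus_commute)
    then show "v \<in> generic_tuples"
      using v by (auto simp: generic_tuples_def space_PiM space_sphere_measure PiE_def Pi_def)
  qed
  ultimately show ?thesis
    using emeasure_mono[OF _ generic_tuples_sets] by (metis le_zero_eq)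
qed

lemma frame_orthogonal:
  assumes "v \<in> generic_tuples"
  shows "orthogonal_matrix (frame v)"
proof -
  have nz: "gram_schmidt v j \<noteq> 0" for j using assms by (simp add: generic_tuples_def)
  have "gram_schmidt v i \<bullet> gram_schmidt v j = 0" if "i \<noteq> j" for i j
    using gram_schmidt_orthogonal[OF nz, of i j] gram_schmidt_orthogonal[OF nz, of j i] that
    by (cases i j rule: linorder_cases) (auto simp: inner_commute)
  moreover have "column j (frame v) = gram_schmidt v j" for j
    by (simp add: frame_def column_def vec_eq_iff)
  ultimately show ?thesis
    by (simp add: orthogonal_matrix_orthonormal_columns orthogonal_def gram_schmidt_norm nz)
qed

lemma frame_rotate:
  assumes "orthogonal_matrix U"
  shows "frame (\<lambda>i. U *v v i) = U ** frame v"
proof -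
  have "orthogonal_transformation ((*v) U)"
    using assms by (simp add: orthogonal_transformation_matrix)
  then have "gram_schmidt (\<lambda>i. U *v v i) k = U *v gram_schmidt v k" for k
    by (rule gram_schmidt_rotate)
  then show ?thesis
    by (simp add: frame_def vec_eq_iff matrix_matrix_mult_def) (simp add: matrix_vector_mult_def)
qed

lemma distr_sphere_tuples:
  fixes U :: "real ^ 'n::{finite, wellorder} \<Rightarrow> real ^ 'n::{finite, wellorder}"
  assumes U: "orthogonal_transformation U"
  shows "distr sphere_tuples sphere_tuples (\<lambda>v i. U (v i)) = (sphere_tuples :: ('n \<Rightarrow> _) measure)"
proof -
  have "distr (PiM (UNIV :: 'n set) (\<lambda>_. \<sigma>)) (PiM UNIV (\<lambda>_. \<sigma>)) (compose UNIV U)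
      = PiM UNIV (\<lambda>_. distr \<sigma> \<sigma> U)"
    by (intro distr_PiM_finite_prob_space' prob_space_sphere_measure measurable_rotation U) auto
  moreover have "compose UNIV U = (\<lambda>v (i::'n). U (v i))" by (auto simp: compose_def fun_eq_iff)
  ultimately show ?thesis by (simp add: distr_rotation[OF U])
qed

lemma orthogonal_transformation_eq_0:
  "orthogonal_transformation T \<Longrightarrow> T x = 0 \<longleftrightarrow> x = 0"
  by (metis norm_eq_zero orthogonal_transformation_norm)

text \<open>A measure on all matrices rather than on the group alone; it is carried by the
  orthogonal ones, and integrands may take any convenient value elsewhere.\<close>

definition haar :: "'n::{finite, wellorder} mat measure" where
  "haar = distr (uniform_measure sphere_tuples generic_tuples) borel frame"

lemma prob_space_haar: "prob_space (haar :: 'n::{finite, wellorder} mat measure)"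
proof -
  interpret prob_space "sphere_tuples :: 'n::{finite, wellorder} tuple measure" by (rule prob_space_sphere_tuples)
  have "prob_space (uniform_measure sphere_tuples (generic_tuples :: 'n tuple set))"
    by (intro prob_space_uniform_measure generic_tuples_pos) simp
  then show ?thesis
    unfolding haar_def by (rule prob_space.prob_space_distr) (use frame_measurable in \<open>simp cong: measurable_cong_sets\<close>)
qed

lemma sets_haar [measurable_cong]: "sets haar = sets borel"
  by (simp add: haar_def)

lemma closed_orthogonal_matrix: "closed {A :: real ^ 'n ^ 'n. orthogonal_matrix A}"
  unfolding orthogonal_matrix matrix_matrix_mult_def transpose_def
  by (intro closed_Collect_eq continuous_intros continuous_on_component)

lemma AE_haar_orthogonal: "AE A in (haar :: 'n::{finite, wellorder} mat measure). orthogonal_matrix A"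
proof -
  have "AE v in uniform_measure sphere_tuples (generic_tuples :: 'n tuple set). orthogonal_matrix (frame v)"
    by (rule AE_uniform_measureI) (auto simp: generic_tuples_sets frame_orthogonal)
  then show ?thesis
    unfolding haar_def using closed_orthogonal_matrix
    by (subst AE_distr_iff) (use frame_measurable in \<open>auto cong: measurable_cong_sets intro: borel_closed\<close>)
qed

lemma haar_left_invariant:
  fixes U :: "'n::{finite, wellorder} mat"
  assumes U: "orthogonal_matrix U"
  shows "distr haar borel (\<lambda>A. U ** A) = haar"
proof -
  let ?M = "uniform_measure sphere_tuples (generic_tuples :: 'n tuple set)"
  let ?T = "\<lambda>v i. U *v v i"
  have oU: "orthogonal_transformation ((*v) U)"
    using U by (simp add: orthogonal_transformation_matrix)
  have T: "?T \<in> sphere_tuples \<rightarrow>\<^sub>M sphere_tuples"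
  proof (rule measurable_PiM_single')
    show "(\<lambda>v. U *v v i) \<in> sphere_tuples \<rightarrow>\<^sub>M \<sigma>" for i
      by (rule measurable_compose[OF measurable_component_singleton[of i UNIV "\<lambda>_. \<sigma>"]
            measurable_rotation[OF oU]]) simp
    show "?T \<in> space sphere_tuples \<rightarrow> (\<Pi>\<^sub>E i\<in>UNIV. space \<sigma>)"
    proof
      fix v :: "'n::{finite, wellorder} tuple" assume "v \<in> space sphere_tuples"
      then have "U *v v i \<in> space \<sigma>" for i
        using measurable_space[OF measurable_rotation[OF oU], of "v i"] by (simp add: space_PiM PiE_iff)
      then show "?T v \<in> (\<Pi>\<^sub>E i\<in>UNIV. space \<sigma>)" by (simp add: PiE_iff)
    qed
  qed
  have gen: "?T v \<in> generic_tuples \<longleftrightarrow> v \<in> generic_tuples" if "v \<in> space sphere_tuples" for v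
    using that measurable_space[OF T that] oU
    by (simp add: generic_tuples_def gram_schmidt_rotate[OF oU] orthogonal_transformation_eq_0[OF oU])
  \<comment> \<open>Conditioning commutes with the rotation: the product measure is invariant, and
    by \<open>gen\<close> so is the event conditioned on.\<close>
  have "distr ?M sphere_tuples ?T = ?M"
  proof (rule measure_eqI)
    fix B assume "B \<in> sets (distr ?M sphere_tuples ?T)"
    then have B: "B \<in> sets sphere_tuples" by simp
    have TB: "?T -` B' \<inter> space sphere_tuples \<in> sets sphere_tuples" if "B' \<in> sets sphere_tuples" for B'
      using T that by (rule measurable_sets)
    have "generic_tuples \<inter> (?T -` B \<inter> space sphere_tuples)
        = ?T -` (generic_tuples \<inter> B) \<inter> space sphere_tuples"
      using gen by (auto simp: generic_tuples_def)
    then have "emeasure sphere_tuples (generic_tuples \<inter> (?T -` B \<inter> space sphere_tuples))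
        = emeasure (distr sphere_tuples sphere_tuples ?T) (generic_tuples \<inter> B)"
      by (simp only: emeasure_distr[OF T sets.Int[OF generic_tuples_sets B]])
    also have "\<dots> = emeasure sphere_tuples (generic_tuples \<inter> B)"
      using distr_sphere_tuples[OF oU] by simp
    finally show "emeasure (distr ?M sphere_tuples ?T) B = emeasure ?M B"
      using T B by (simp add: emeasure_distr emeasure_uniform_measure[OF generic_tuples_sets TB[OF B]]
          emeasure_uniform_measure[OF generic_tuples_sets B] del: emeasure_uniform_measure)
  qed simp
  then have "haar = distr (distr ?M sphere_tuples ?T) borel frame"
    by (simp add: haar_def)
  also have "\<dots> = distr ?M borel (\<lambda>v. frame (?T v))"
    using T frame_measurable by (subst distr_distr) (auto simp: comp_def)
  also have "\<dots> = distr ?M borel (\<lambda>v. U ** frame v)"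
    using U by (simp add: frame_rotate)
  also have "\<dots> = distr haar borel (\<lambda>A. U ** A)"
  proof -
    have "(\<lambda>A. U ** A) \<in> borel \<rightarrow>\<^sub>M borel"
      unfolding matrix_matrix_mult_def
      by (intro borel_measurable_continuous_onI continuous_intros continuous_on_component)
    then show ?thesis
      unfolding haar_def using frame_measurable by (subst distr_distr) (auto simp: comp_def cong: measurable_cong_sets)
  qed
  finally show ?thesis by simp
qed

section \<open>Averaging projections\<close>

declare transpose_matrix_vector [simp del]

lemma C_sphere_simps:
  "vadd C_sphere f g = (\<lambda>x. f x + g x)" "vscale C_sphere c f = (\<lambda>x. c * f x)"
  "vdiff C_sphere f g = (\<lambda>x. f x - g x)"
  by (simp_all add: C_sphere_def vdiff_def)

lemma restrict_to_simps [simp]: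
  "pts (restrict_to Y X) = X" "vadd (restrict_to Y X) = vadd Y" "vscale (restrict_to Y X) = vscale Y"
  "vnorm (restrict_to Y X) = vnorm Y" "vzero (restrict_to Y X) = vzero Y"
  by (simp_all add: restrict_to_def)

lemma CS_cmod_le: "f \<in> CS \<Longrightarrow> norm x = 1 \<Longrightarrow> cmod (f x) \<le> vnorm C_sphere f"
  by (rule C_sphere_cmod_le) auto

lemma CS_norm_nonneg: "f \<in> CS \<Longrightarrow> 0 \<le> vnorm C_sphere f"
  by (rule complex_normed_space.norm_nonneg[OF complex_banach_space.axioms(1)[OF C_sphere_complex_banach_space]])

lemma CS_diff: "f \<in> CS \<Longrightarrow> g \<in> CS \<Longrightarrow> (\<lambda>x. f x - g x) \<in> CS"
  using cfun.subspace_diff[OF subspace_CS, of f g] by (simp add: fun_diff_def)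

lemma norm_l2_inner_le:
  assumes "f \<in> CS" "g \<in> CS"
  shows "cmod (l2_inner f g) \<le> vnorm C_sphere f * vnorm C_sphere g"
proof -
  interpret prob_space \<sigma> by (rule prob_space_sphere_measure)
  have "cmod (l2_inner f g) \<le> (LINT y|\<sigma>. cmod (f y * cnj (g y)))"
    unfolding l2_inner_def by (rule integral_norm_bound)
  also have "\<dots> \<le> (LINT y|(\<sigma> :: (real ^ 'a) measure). vnorm C_sphere f * vnorm C_sphere g)"
    using assms
    by (intro integral_mono integrable_norm integrable_inner_CS)
      (auto simp: norm_mult space_sphere_measure intro!: mult_mono CS_cmod_le CS_norm_nonneg)
  finally show ?thesis by (simp add: prob_space)
qed

lemma CS_norm_rotate_le:
  fixes f :: "'n::finite cfun" and T :: "real ^ 'n \<Rightarrow> real ^ 'n"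
  assumes "f \<in> CS" "orthogonal_transformation T"
  shows "vnorm C_sphere (f \<circ> T) \<le> vnorm C_sphere f"
  using assms by (intro C_sphere_norm_le) (auto intro!: CS_cmod_le simp: orthogonal_transformation_norm)

section \<open>The rotation action on continuous functions\<close>

lemma orthogonal_matrix_transformation:
  fixes A :: "'n::finite mat"
  shows "orthogonal_matrix A \<Longrightarrow> orthogonal_transformation ((*v) A)"
  by (simp add: orthogonal_transformation_matrix)

lemma orthogonal_matrix_cancel:
  fixes A :: "'n::finite mat"
  assumes "orthogonal_matrix A"
  shows "transpose A *v (A *v x) = x" "A *v (transpose A *v x) = x"
  using assms by (simp_all add: orthogonal_matrix_def matrix_vector_mul_assoc)

text \<open>Strong continuity of the action: \<open>f\<close> is uniformly continuous on the compact
  sphere, and the sum of the absolute entries of \<open>A i - A0\<close> bounds its operator norm,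
  so the points \<open>A i *v x\<close> converge uniformly in \<open>x\<close>.\<close>

lemma CS_rotate_tendsto:
  fixes f :: "'n::finite cfun" and A :: "nat \<Rightarrow> 'n mat"
  assumes f: "f \<in> CS" and A: "\<And>i. orthogonal_matrix (A i)" "orthogonal_matrix A0" "A \<longlonglongrightarrow> A0"
  shows "(\<lambda>i. vnorm C_sphere (\<lambda>x. (f \<circ> (*v) (A i)) x - (f \<circ> (*v) A0) x)) \<longlonglongrightarrow> 0"
proof (rule LIMSEQ_I)
  fix e :: real assume e: "0 < e"
  have "uniformly_continuous_on (sphere 0 1) f"
    by (intro compact_uniformly_continuous CS_continuous f) auto
  then obtain d where d: "0 < d" "\<And>x y. norm x = 1 \<Longrightarrow> norm y = 1 \<Longrightarrow> dist y x < d \<Longrightarrow> dist (f y) (f x) < e / 2"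
    unfolding uniformly_continuous_on_def using e by (metis half_gt_zero mem_sphere_0)
  have "(\<lambda>i. \<Sum>k\<in>UNIV. \<Sum>l\<in>UNIV. \<bar>(A i - A0) $ k $ l\<bar>) \<longlonglongrightarrow> (\<Sum>k\<in>UNIV. \<Sum>l\<in>UNIV. \<bar>(A0 - A0) $ k $ l\<bar>)"
    by (intro tendsto_sum tendsto_rabs tendsto_vec_nth tendsto_diff A tendsto_const)
  then have "\<forall>\<^sub>F i in sequentially. (\<Sum>k\<in>UNIV. \<Sum>l\<in>UNIV. \<bar>(A i - A0) $ k $ l\<bar>) < d"
    using d(1) by (intro order_tendstoD(2)) auto
  then obtain N where N: "\<And>i. i \<ge> N \<Longrightarrow> (\<Sum>k\<in>UNIV. \<Sum>l\<in>UNIV. \<bar>(A i - A0) $ k $ l\<bar>) < d"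
    unfolding eventually_sequentially by blast
  have "vnorm C_sphere (\<lambda>x. (f \<circ> (*v) (A i)) x - (f \<circ> (*v) A0) x) \<le> e / 2" if "i \<ge> N" for i
  proof (rule C_sphere_norm_le)
    fix x :: "real ^ 'n" assume "x \<in> sphere 0 1"
    then have x: "norm x = 1" by simp
    have "norm (A i *v x - A0 *v x) = norm ((A i - A0) *v x)"
      by (simp add: matrix_vector_mult_diff_rdistrib)
    also have "\<dots> \<le> onorm ((*v) (A i - A0)) * norm x"
      by (intro onorm) (simp add: linear_conv_bounded_linear[symmetric])
    also have "\<dots> < d"
      using onorm_le_matrix_component_sum[of "A i - A0"] N[OF that] x by simp
    finally have "dist (A i *v x) (A0 *v x) < d" by (simp add: dist_norm)
    then have "dist (f (A i *v x)) (f (A0 *v x)) < e / 2"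
      using x A(1)[THEN orthogonal_matrix_transformation] A(2)[THEN orthogonal_matrix_transformation]
      by (intro d(2)) (simp_all add: orthogonal_transformation_norm)
    then show "cmod ((f \<circ> (*v) (A i)) x - (f \<circ> (*v) A0) x) \<le> e / 2"
      by (simp add: dist_norm)
  qed
  moreover have nn: "0 \<le> vnorm C_sphere (\<lambda>x. (f \<circ> (*v) (A i)) x - (f \<circ> (*v) A0) x)" for i
    by (intro CS_norm_nonneg CS_diff CS_rotate f orthogonal_matrix_transformation A)
  ultimately have "norm (vnorm C_sphere (\<lambda>x. (f \<circ> (*v) (A i)) x - (f \<circ> (*v) A0) x) - 0) < e" if "i \<ge> N" for i
    using that e nn[of i] by (auto simp del: comp_apply intro: le_less_trans[of _ "e / 2"])
  then show "\<exists>N. \<forall>i\<ge>N. norm (vnorm C_sphere (\<lambda>x. (f \<circ> (*v) (A i)) x - (f \<circ> (*v) A0) x) - 0) < e"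
    by blast
qed

lemma projection_ontoD:
  assumes "projection_onto Y X P"
  shows "\<And>x. x \<in> pts Y \<Longrightarrow> P x \<in> X" "\<And>x. x \<in> X \<Longrightarrow> P x = x"
    "\<And>x y. x \<in> pts Y \<Longrightarrow> y \<in> pts Y \<Longrightarrow> P (vadd Y x y) = vadd Y (P x) (P y)"
    "\<And>a x. x \<in> pts Y \<Longrightarrow> P (vscale Y a x) = vscale Y a (P x)"
    "\<exists>K. \<forall>x\<in>pts Y. vnorm Y (P x) \<le> K * vnorm Y x"
  using assms by (auto simp: projection_onto_def bounded_clinear_map_def clinear_map_def)

context
  fixes S B :: "'n::{finite, wellorder} cfun set" and P :: "'n::{finite, wellorder} cfun \<Rightarrow> 'n cfun"
    and K :: real
  assumes SC: "S \<subseteq> CS" and inv: "orthogonal_invariant S" and ob: "orthonormal_basis S B"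
    and P: "projection_onto C_sphere S P"
    and K0: "0 \<le> K" and K': "\<forall>f\<in>CS. vnorm C_sphere (P f) \<le> K * vnorm C_sphere f"
begin

lemmas K = K'[rule_format]

text \<open>The transpose is the inverse of \<open>A\<close>. The value 0 off the group keeps
  membership in \<open>S\<close> and the norm bound true for every matrix, and makes the integrands
  Borel on the whole matrix space.\<close>

definition conjugate :: "'n mat \<Rightarrow> 'n cfun \<Rightarrow> 'n cfun" where
  "conjugate A f = (if orthogonal_matrix A then P (f \<circ> (*v) A) \<circ> (*v) (transpose A) else (\<lambda>x. 0))"

text \<open>Integrating coefficients puts the values in \<open>S\<close> by construction and
  involves scalar integrands only; \<open>average_eq\<close> shows that this is the pointwise
  integral.\<close>

definition average :: "'n cfun \<Rightarrow> 'n cfun" where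
  "average f x = (\<Sum>b\<in>B. (LINT A|haar. l2_inner (conjugate A f) b) * b x)"

lemma P_CS: "f \<in> CS \<Longrightarrow> P f \<in> CS"
  using projection_ontoD(1)[OF P] SC by auto

lemma CS_rotate_matrix: "f \<in> CS \<Longrightarrow> orthogonal_matrix A \<Longrightarrow> f \<circ> (*v) A \<in> CS" for A :: "'n mat"
  by (intro CS_rotate orthogonal_matrix_transformation)

lemma conjugate_mem: "f \<in> CS \<Longrightarrow> conjugate A f \<in> S"
proof (cases "orthogonal_matrix A")
  case True
  assume "f \<in> CS"
  then have "P (f \<circ> (*v) A) \<in> S" using True by (intro projection_ontoD(1)[OF P] CS_rotate_matrix)
  then show ?thesis
    using inv True orthogonal_matrix_transformation[of "transpose A"]
    by (simp add: conjugate_def orthogonal_invariant_def)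
next
  case False
  have "cfun.subspace S" using ob by (auto simp: orthonormal_basis_def)
  then show ?thesis using False cfun.subspace_0[of S] by (simp add: conjugate_def zero_fun_def)
qed

lemma conjugate_le:
  assumes f: "f \<in> CS" and x: "norm x = 1" shows "cmod (conjugate A f x) \<le> K * vnorm C_sphere f"
proof (cases "orthogonal_matrix A")
  case True
  then have fA: "f \<circ> (*v) A \<in> CS" by (rule CS_rotate_matrix[OF f])
  have n: "norm (transpose A *v x) = 1"
    using orthogonal_matrix_transformation[of "transpose A"] True x by (simp add: orthogonal_transformation_norm)
  have "cmod (conjugate A f x) \<le> vnorm C_sphere (P (f \<circ> (*v) A))"
    using CS_cmod_le[OF P_CS[OF fA] n] True by (simp add: conjugate_def)
  also have "\<dots> \<le> K * vnorm C_sphere (f \<circ> (*v) A)" by (rule K[OF fA])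
  also have "\<dots> \<le> K * vnorm C_sphere f"
    using K0 CS_norm_rotate_le[OF f orthogonal_matrix_transformation[OF True]]
    by (rule mult_left_mono[rotated])
  finally show ?thesis .
next
  case False
  then show ?thesis using K0 CS_norm_nonneg[OF f] by (simp add: conjugate_def)
qed

text \<open>At a point \<open>x\<close> the difference of the conjugates for \<open>A i\<close> and
  \<open>A0\<close> splits in two: \<open>P\<close> applied to
  \<open>f \<circ> A i - f \<circ> A0\<close>, and the fixed function
  \<open>g = P (f \<circ> A0)\<close> under two rotations. Boundedness of \<open>P\<close> and
  strong continuity make both tend to 0 uniformly in \<open>x\<close>.\<close>

lemma conjugate_inner_continuous:
  assumes f: "f \<in> CS" and b: "b \<in> CS"
  shows "continuous_on {A. orthogonal_matrix A} (\<lambda>A. l2_inner (conjugate A f) b)"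
  unfolding continuous_on_sequentially
proof (intro allI ballI impI, elim conjE)
  fix A :: "nat \<Rightarrow> 'n mat" and A0
  assume "A0 \<in> {A. orthogonal_matrix A}" "\<forall>i. A i \<in> {A. orthogonal_matrix A}" and lim: "A \<longlonglongrightarrow> A0"
  then have A0: "orthogonal_matrix A0" and A: "\<And>i. orthogonal_matrix (A i)" by auto
  have limt: "(\<lambda>i. transpose (A i)) \<longlonglongrightarrow> transpose A0"
    unfolding transpose_def by (intro tendsto_vec_lambda tendsto_vec_nth lim)
  let ?n = "vnorm C_sphere :: 'n cfun \<Rightarrow> real"
  define F :: "'n mat \<Rightarrow> 'n cfun" where "F M = f \<circ> (*v) M" for M
  define g where "g = P (F A0)"
  let ?d1 = "\<lambda>i x. F (A i) x - F A0 x"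
  let ?d2 = "\<lambda>i x. (g \<circ> (*v) (transpose (A i))) x - (g \<circ> (*v) (transpose A0)) x"
  have fC: "F (A i) \<in> CS" "F A0 \<in> CS" for i
    unfolding F_def using f A A0 by (intro CS_rotate_matrix; simp)+
  have gC: "g \<in> CS" unfolding g_def by (rule P_CS[OF fC(2)])
  have d1C: "?d1 i \<in> CS" for i by (intro CS_diff fC)
  have d2C: "?d2 i \<in> CS" for i
    using A A0 by (intro CS_diff CS_rotate_matrix gC) auto
  have "?n (\<lambda>x. conjugate (A i) f x - conjugate A0 f x) \<le> K * ?n (?d1 i) + ?n (?d2 i)" for i
  proof (rule C_sphere_norm_le)
    fix x :: "real ^ 'n::{finite, wellorder}" assume "x \<in> sphere 0 1"
    then have x: "norm x = 1" by simp
    have n: "norm (transpose (A i) *v x) = 1"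
      using orthogonal_matrix_transformation[of "transpose (A i)"] A x by (simp add: orthogonal_transformation_norm)
    have "P (?d1 i) = (\<lambda>x. P (F (A i)) x - P (F A0) x)"
      using projection_ontoD(3)[OF P fC(1)[of i], of "vscale C_sphere (-1) (F A0)"] projection_ontoD(4)[OF P fC(2), of "-1"]
        cfun.subspace_scale[OF subspace_CS fC(2), of "-1"]
      by (simp add: C_sphere_simps)
    then have "conjugate (A i) f x - conjugate A0 f x = P (?d1 i) (transpose (A i) *v x) + ?d2 i x"
      using A A0 by (simp add: conjugate_def g_def F_def)
    also have "cmod \<dots> \<le> cmod (P (?d1 i) (transpose (A i) *v x)) + cmod (?d2 i x)"
      by (rule norm_triangle_ineq)
    also have "\<dots> \<le> K * ?n (?d1 i) + ?n (?d2 i)"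
      using CS_cmod_le[OF P_CS[OF d1C] n, of i] K[OF d1C, of i] CS_cmod_le[OF d2C x, of i]
      by linarith
    finally show "cmod (conjugate (A i) f x - conjugate A0 f x) \<le> K * ?n (?d1 i) + ?n (?d2 i)" .
  qed
  moreover have "cmod (l2_inner (conjugate (A i) f) b - l2_inner (conjugate A0 f) b)
      \<le> ?n (\<lambda>x. conjugate (A i) f x - conjugate A0 f x) * ?n b" for i
  proof -
    have C: "conjugate M f \<in> CS" for M using conjugate_mem[OF f] SC by auto
    show ?thesis
      using norm_l2_inner_le[OF CS_diff[OF C C] b] by (simp add: l2_inner_diff_left C b)
  qed
  ultimately have le: "cmod (l2_inner (conjugate (A i) f) b - l2_inner (conjugate A0 f) b)
      \<le> (K * ?n (?d1 i) + ?n (?d2 i)) * ?n b" for i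
    using CS_norm_nonneg[OF b] by (meson mult_right_mono order_trans)
  have t1: "(\<lambda>i. ?n (?d1 i)) \<longlonglongrightarrow> 0"
    unfolding F_def by (rule CS_rotate_tendsto[OF f A A0 lim])
  have t2: "(\<lambda>i. ?n (?d2 i)) \<longlonglongrightarrow> 0"
    by (rule CS_rotate_tendsto[OF gC _ _ limt]) (use A A0 in simp_all)
  have "(\<lambda>i. (K * ?n (?d1 i) + ?n (?d2 i)) * ?n b) \<longlonglongrightarrow> 0"
    using tendsto_mult_right[OF tendsto_add[OF tendsto_mult_left[OF t1, of K] t2], of "?n b"] by simp
  then have "(\<lambda>i. l2_inner (conjugate (A i) f) b - l2_inner (conjugate A0 f) b) \<longlonglongrightarrow> 0"
    by (rule Lim_null_comparison[OF always_eventually, rotated]) (use le in blast)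
  then show "((\<lambda>A. l2_inner (conjugate A f) b) \<circ> A) \<longlonglongrightarrow> l2_inner (conjugate A0 f) b"
    by (simp add: LIM_zero_iff comp_def)
qed

lemma conjugate_inner_integrable:
  assumes f: "f \<in> CS" and b: "b \<in> CS"
  shows "integrable haar (\<lambda>A. l2_inner (conjugate A f) b)"
proof -
  interpret prob_space "haar :: 'n mat measure" by (rule prob_space_haar)
  \<comment> \<open>Borel because it is continuous on a closed set and constant off it.\<close>
  have "(\<lambda>A. if A \<in> {A. orthogonal_matrix A} then l2_inner (conjugate A f) b else 0) \<in> borel_measurable borel"
    by (intro borel_measurable_continuous_on_if borel_closed closed_orthogonal_matrix
        conjugate_inner_continuous f b continuous_on_const)
  also have "(\<lambda>A. if A \<in> {A. orthogonal_matrix A} then l2_inner (conjugate A f) b else 0)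
      = (\<lambda>A. l2_inner (conjugate A f) b)"
    by (auto simp: conjugate_def l2_inner_def)
  finally have m: "(\<lambda>A. l2_inner (conjugate A f) b) \<in> borel_measurable haar"
    by (simp cong: measurable_cong_sets add: sets_haar)
  have "cmod (l2_inner (conjugate A f) b) \<le> K * vnorm C_sphere f * vnorm C_sphere b" for A
  proof -
    have "conjugate A f \<in> CS" using conjugate_mem[OF f] SC by auto
    then have "cmod (l2_inner (conjugate A f) b) \<le> vnorm C_sphere (conjugate A f) * vnorm C_sphere b"
      by (intro norm_l2_inner_le b)
    also have "\<dots> \<le> K * vnorm C_sphere f * vnorm C_sphere b"
      using conjugate_le[OF f] by (intro mult_right_mono C_sphere_norm_le CS_norm_nonneg b) auto
    finally show ?thesis .
  qed
  then show ?thesis by (intro integrable_const_bound[OF _ m]) auto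
qed

lemma average_eq:
  assumes f: "f \<in> CS"
  shows "average f x = (LINT A|haar. conjugate A f x)"
    and "integrable haar (\<lambda>A. conjugate A f x)"
proof -
  have bC: "b \<in> CS" if "b \<in> B" for b using orthonormal_basis_CS[OF SC ob that] .
  have e: "conjugate A f x = (\<Sum>b\<in>B. l2_inner (conjugate A f) b * b x)" for A
    by (rule orthonormal_expansion[OF SC ob conjugate_mem[OF f]])
  have i: "integrable haar (\<lambda>A. l2_inner (conjugate A f) b * b x)" if "b \<in> B" for b
    using conjugate_inner_integrable[OF f bC[OF that]] by (rule integrable_mult_left)
  show "integrable haar (\<lambda>A. conjugate A f x)"
    by (subst e) (rule Bochner_Integration.integrable_sum, rule i)
  have "(LINT A|haar. conjugate A f x) = (LINT A|haar. (\<Sum>b\<in>B. l2_inner (conjugate A f) b * b x))"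
    by (subst e) (rule refl)
  also have "\<dots> = average f x"
    unfolding average_def using i conjugate_inner_integrable[OF f bC] by simp
  finally show "average f x = (LINT A|haar. conjugate A f x)" by simp
qed

lemma average_le:
  assumes f: "f \<in> CS" and x: "norm x = 1" shows "cmod (average f x) \<le> K * vnorm C_sphere f"
proof -
  interpret prob_space "haar :: 'n mat measure" by (rule prob_space_haar)
  have "cmod (average f x) \<le> (LINT A|(haar :: 'n mat measure). cmod (conjugate A f x))"
    unfolding average_eq[OF f] by (rule integral_norm_bound)
  also have "\<dots> \<le> (LINT A|(haar :: 'n mat measure). K * vnorm C_sphere f)"
    using conjugate_le[OF f x] average_eq(2)[OF f] by (intro integral_mono) auto
  finally show ?thesis by (simp add: prob_space)
qed

text \<open>With \<open>U\<close> the matrix of \<open>T\<close>, the substitution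
  \<open>A \<mapsto> U ** A\<close> turns \<open>f \<circ> A\<close> into
  \<open>(f \<circ> T) \<circ> A\<close>, while the inverse of \<open>U ** A\<close> sends
  \<open>T x\<close> to the image of \<open>x\<close> under the inverse of \<open>A\<close>. It thus
  moves \<open>T\<close> from the point to the function, and left invariance absorbs it.\<close>

lemma average_equivariant:
  assumes f: "f \<in> CS" and T: "orthogonal_transformation T"
  shows "average (f \<circ> T) = average f \<circ> T"
proof
  fix x
  let ?U = "matrix T"
  have U: "orthogonal_matrix ?U" and TU: "T = (*v) ?U"
    using T by (auto simp: orthogonal_transformation_matrix fun_eq_iff)
  have conj: "conjugate (?U ** A) f (T x) = conjugate A (f \<circ> T) x" for A
  proof -
    \<comment> \<open>Both sides must fall into the same case of \<open>conjugate\<close>.\<close>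
    have "orthogonal_matrix (?U ** A) \<longleftrightarrow> orthogonal_matrix A"
    proof
      assume "orthogonal_matrix (?U ** A)"
      then have "orthogonal_matrix (transpose ?U ** (?U ** A))"
        using U by (subst orthogonal_matrix_mul) simp_all
      then show "orthogonal_matrix A"
        using U matrix_mul_assoc[of "transpose ?U" ?U A] by (simp add: orthogonal_matrix_def[of ?U])
    qed (use U orthogonal_matrix_mul in auto)
    moreover have "f \<circ> (*v) (?U ** A) = (f \<circ> T) \<circ> (*v) A"
      by (subst TU) (simp add: comp_def matrix_vector_mul_assoc)
    moreover have "transpose (?U ** A) *v (T x) = transpose A *v x"
      using orthogonal_matrix_cancel(1)[OF U]
      by (subst TU) (simp add: matrix_transpose_mul matrix_vector_mul_assoc[symmetric])
    ultimately show ?thesis by (simp add: conjugate_def)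
  qed
  have fT: "f \<circ> T \<in> CS" by (rule CS_rotate[OF f T])
  have "(LINT A|haar. conjugate A f (T x)) = (LINT A|distr haar borel (\<lambda>A. ?U ** A). conjugate A f (T x))"
    by (simp add: haar_left_invariant[OF U])
  also have "\<dots> = (LINT A|haar. conjugate (?U ** A) f (T x))"
  proof (rule integral_distr)
    have "(\<lambda>A. ?U ** A) \<in> borel \<rightarrow>\<^sub>M borel"
      unfolding matrix_matrix_mult_def
      by (intro borel_measurable_continuous_onI continuous_intros continuous_on_component)
    then show "(\<lambda>A. ?U ** A) \<in> haar \<rightarrow>\<^sub>M borel"
      by (simp cong: measurable_cong_sets add: sets_haar)
    show "(\<lambda>A. conjugate A f (T x)) \<in> borel_measurable borel"
      using borel_measurable_integrable[OF average_eq(2)[OF f]]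
      by (simp cong: measurable_cong_sets add: sets_haar)
  qed
  also have "\<dots> = (LINT A|haar. conjugate A (f \<circ> T) x)" by (simp add: conj)
  finally show "average (f \<circ> T) x = (average f \<circ> T) x"
    by (simp add: average_eq[OF f] average_eq[OF fT])
qed

lemma average_projection: "equivariant_projection S average"
  unfolding equivariant_projection_def projection_onto_def bounded_clinear_map_def clinear_map_def
proof (intro conjI ballI allI impI)
  show "average f \<in> pts (restrict_to C_sphere S)" for f
    unfolding average_def restrict_to_simps by (rule orthonormal_basis_comb[OF SC ob])
  show "average (vadd C_sphere f g) = vadd (restrict_to C_sphere S) (average f) (average g)"
    if f: "f \<in> CS" and g: "g \<in> CS" for f g
  proof
    fix x
    have fg: "(\<lambda>x. f x + g x) \<in> CS"
      using cfun.subspace_add[OF subspace_CS f g] by (simp add: plus_fun_def)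
    have "conjugate A (\<lambda>x. f x + g x) x = conjugate A f x + conjugate A g x" for A
      using projection_ontoD(3)[OF P CS_rotate_matrix[OF f] CS_rotate_matrix[OF g], of A A]
      by (simp add: conjugate_def C_sphere_simps comp_def)
    then show "average (vadd C_sphere f g) x = vadd (restrict_to C_sphere S) (average f) (average g) x"
      using average_eq(2)[OF f] average_eq(2)[OF g]
      by (simp add: C_sphere_simps average_eq(1)[OF f] average_eq(1)[OF g] average_eq(1)[OF fg])
  qed
  show "average (vscale C_sphere a f) = vscale (restrict_to C_sphere S) a (average f)"
    if f: "f \<in> CS" for a f
  proof
    fix x
    have fg: "(\<lambda>x. a * f x) \<in> CS"
      using cfun.subspace_scale[OF subspace_CS f] by simp
    have "conjugate A (\<lambda>x. a * f x) x = a * conjugate A f x" for A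
      using projection_ontoD(4)[OF P CS_rotate_matrix[OF f], of A a]
      by (simp add: conjugate_def C_sphere_simps comp_def)
    then show "average (vscale C_sphere a f) x = vscale (restrict_to C_sphere S) a (average f) x"
      by (simp add: C_sphere_simps average_eq(1)[OF f] average_eq(1)[OF fg])
  qed
  have "vnorm C_sphere (average f) \<le> K * vnorm C_sphere f" if f: "f \<in> CS" for f
    by (intro C_sphere_norm_le average_le f) simp
  then show "\<exists>K. \<forall>f\<in>CS. vnorm (restrict_to C_sphere S) (average f) \<le> K * vnorm C_sphere f"
    by auto
  show "average f = f" if f: "f \<in> S" for f
  proof
    fix x
    interpret prob_space "haar :: 'n mat measure" by (rule prob_space_haar)
    have fC: "f \<in> CS" using f SC by auto
    have "conjugate A f x = f x" if A: "orthogonal_matrix A" for A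
    proof -
      \<comment> \<open>Invariance of \<open>S\<close> puts the rotated function where
        \<open>P\<close> is the identity, so the two rotations cancel.\<close>
      have "f \<circ> (*v) A \<in> S"
        using inv f orthogonal_matrix_transformation[OF A] by (auto simp: orthogonal_invariant_def)
      then show ?thesis
        using A by (simp add: conjugate_def projection_ontoD(2)[OF P] orthogonal_matrix_cancel)
    qed
    then have "AE A in haar. conjugate A f x = f x"
      using AE_haar_orthogonal by (auto elim: eventually_mono)
    then have "(LINT A|haar. conjugate A f x) = (LINT A|(haar :: 'n mat measure). f x)"
      using average_eq(2)[OF fC] by (intro integral_cong_AE) auto
    then show "average f x = f x" by (simp add: average_eq(1)[OF fC] prob_space)
  qed
qed (rule average_equivariant)

end

text \<open>Averaging does not increase a norm bound, and by uniqueness every average is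
  \<open>R\<close> on continuous functions. Hence \<open>R\<close> satisfies every norm bound that
  some projection onto \<open>S\<close> satisfies.\<close>

lemma unique_equivariant_projection_norm_le:
  fixes S :: "'n::{finite, wellorder} cfun set"
  assumes S: "finite_dim_subspace S" and inv: "orthogonal_invariant S"
    and uniq: "\<And>Q. equivariant_projection S Q \<Longrightarrow> (\<forall>f\<in>CS. Q f = R f)"
    and P: "projection_onto C_sphere S P"
    and K: "0 \<le> K" "\<forall>f\<in>CS. vnorm C_sphere (P f) \<le> K * vnorm C_sphere f"
    and f: "f \<in> CS"
  shows "vnorm C_sphere (R f) \<le> K * vnorm C_sphere f"
proof -
  have SC: "S \<subseteq> CS" using S by (simp add: finite_dim_subspace_def)
  obtain B where B: "orthonormal_basis S B" using ex_orthonormal_basis[OF S] by blast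
  note * = average_projection[OF SC inv B P K] average_le[OF SC inv B P K]
  have "R f = average B P f" using uniq[OF *(1)] f by simp
  then show ?thesis using *(2)[OF f] by (auto intro: C_sphere_norm_le)
qed

section \<open>The norm of the orthogonal projection\<close>

text \<open>The reproducing kernel with the basis as a parameter instead of a choice.\<close>

definition basis_kernel :: "'n::finite cfun set \<Rightarrow> real ^ 'n \<Rightarrow> real ^ 'n \<Rightarrow> complex" where
  "basis_kernel B x y = (\<Sum>f\<in>B. cnj (f x) * f y)"

text \<open>For \<open>t > e\<close>, multiply \<open>t - e\<close> by
  \<open>sqrt (t\<^sup>2 + e\<^sup>2) \<le> t + e\<close>. With \<open>t\<close> the modulus of the
  kernel, this says that smoothing the sign of the kernel loses at most \<open>e\<close> in the
  integral over a probability measure.\<close>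

lemma sqrt_regularization:
  fixes t e :: real
  assumes "0 \<le> t" "0 < e"
  shows "t - e \<le> t\<^sup>2 / sqrt (t\<^sup>2 + e\<^sup>2)"
proof (cases "t \<le> e")
  case True
  then have "t - e \<le> 0" by simp
  also have "0 \<le> t\<^sup>2 / sqrt (t\<^sup>2 + e\<^sup>2)" by simp
  finally show ?thesis .
next
  case False
  have "sqrt (t\<^sup>2 + e\<^sup>2) \<le> t + e"
    using assms by (intro real_le_lsqrt) (auto simp: power2_sum)
  then have "(t - e) * sqrt (t\<^sup>2 + e\<^sup>2) \<le> (t - e) * (t + e)"
    using False by (intro mult_left_mono) auto
  also have "\<dots> \<le> t\<^sup>2" by (simp add: algebra_simps power2_eq_square)
  finally have "(t - e) * sqrt (t\<^sup>2 + e\<^sup>2) \<le> t\<^sup>2" .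
  moreover have "0 < sqrt (t\<^sup>2 + e\<^sup>2)" using assms by (simp add: add_nonneg_pos)
  ultimately show ?thesis by (simp add: le_divide_eq)
qed

context
  fixes S B :: "'n::finite cfun set"
  assumes SC: "S \<subseteq> CS" and ob: "orthonormal_basis S B"
begin

lemma basis_kernel_CS: "(\<lambda>y. basis_kernel B x y) \<in> CS"
  using orthonormal_basis_comb[OF SC ob, of "\<lambda>f. cnj (f x)"] SC by (auto simp: basis_kernel_def)

lemma l2_proj_kernel:
  assumes f: "f \<in> CS"
  shows "l2_proj S f x = (LINT y|\<sigma>. f y * cnj (basis_kernel B x y))"
proof -
  have i: "integrable \<sigma> (\<lambda>y. f y * cnj (b y) * b x)" if "b \<in> B" for b
    using integrable_inner_CS[OF f orthonormal_basis_CS[OF SC ob that]] by (rule integrable_mult_left)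
  have "l2_proj S f x = (\<Sum>b\<in>B. (LINT y|\<sigma>. f y * cnj (b y) * b x))"
    by (simp add: l2_proj_eq[OF SC ob f] l2_inner_def)
  also have "\<dots> = (LINT y|\<sigma>. (\<Sum>b\<in>B. f y * cnj (b y) * b x))"
    using i by (simp add: integral_sum)
  also have "\<dots> = (LINT y|\<sigma>. f y * cnj (basis_kernel B x y))"
    by (simp add: basis_kernel_def sum_distrib_left mult_ac)
  finally show ?thesis .
qed

lemma l2_proj_cmod_le:
  assumes f: "f \<in> CS"
  shows "cmod (l2_proj S f x) \<le> vnorm C_sphere f * (LINT y|\<sigma>. cmod (basis_kernel B x y))"
proof -
  have "cmod (l2_proj S f x) \<le> (LINT y|\<sigma>. cmod (f y * cnj (basis_kernel B x y)))"
    unfolding l2_proj_kernel[OF f] by (rule integral_norm_bound)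
  also have "\<dots> \<le> (LINT y|\<sigma>. vnorm C_sphere f * cmod (basis_kernel B x y))"
    using f basis_kernel_CS
    by (intro integral_mono integrable_norm integrable_inner_CS integrable_mult_right integrable_CS)
      (auto simp: norm_mult space_sphere_measure intro!: mult_right_mono CS_cmod_le)
  finally show ?thesis by simp
qed

lemma l2_proj_almost_norming:
  assumes e: "0 < e"
  obtains f where "f \<in> CS" "vnorm C_sphere f \<le> 1"
    "(LINT y|\<sigma>. cmod (basis_kernel B x y)) - e \<le> cmod (l2_proj S f x)"
proof -
  interpret prob_space "\<sigma> :: (real ^ 'n) measure" by (rule prob_space_sphere_measure)
  let ?k = "basis_kernel B x"
  \<comment> \<open>\<open>?k / \<bar>?k\<bar>\<close> would be norming, but need not be continuous at the zeros of \<open>?k\<close>.\<close>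
  define w where "w y = sqrt ((cmod (?k y))\<^sup>2 + e\<^sup>2)" for y
  have w: "0 < w y" "cmod (?k y) \<le> w y" for y
    unfolding w_def using e by (auto simp: add_nonneg_pos intro: real_le_rsqrt)
  define f where "f y = ?k y / complex_of_real (w y)" for y
  have kc: "continuous_on (sphere 0 1) ?k" by (rule CS_continuous[OF basis_kernel_CS])
  have fC: "f \<in> CS"
  proof (rule CS_I)
    have "w y \<noteq> 0" for y using w(1)[of y] by simp
    moreover have "continuous_on (sphere 0 1) w"
      unfolding w_def by (intro continuous_intros kc)
    ultimately show "continuous_on (sphere 0 1) f"
      unfolding f_def by (intro continuous_intros kc) auto
    show "f y = 0" if "norm y \<noteq> 1" for y
      using CS_outside[OF basis_kernel_CS that] by (simp add: f_def)
  qed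
  have "vnorm C_sphere f \<le> 1"
  proof (rule C_sphere_norm_le)
    show "cmod (f y) \<le> 1" for y
      using w[of y] by (simp add: f_def norm_divide)
  qed
  moreover have "(LINT y|\<sigma>. cmod (?k y)) - e \<le> cmod (l2_proj S f x)"
  proof -
    have fk: "f y * cnj (?k y) = complex_of_real ((cmod (?k y))\<^sup>2 / w y)" for y
      by (simp add: f_def complex_norm_square del: of_real_power)
    have "integrable \<sigma> (\<lambda>y. (cmod (?k y))\<^sup>2 / w y)"
      using integrable_inner_CS[OF fC basis_kernel_CS, of x] unfolding fk
      by (simp only: complex_of_real_integrable_eq)
    then have "(LINT y|\<sigma>. cmod (?k y) - e) \<le> (LINT y|\<sigma>. (cmod (?k y))\<^sup>2 / w y)"
      using e sqrt_regularization unfolding w_def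
      by (intro integral_mono Bochner_Integration.integrable_diff integrable_norm integrable_CS basis_kernel_CS) auto
    also have "\<dots> \<le> cmod (complex_of_real (LINT y|\<sigma>. (cmod (?k y))\<^sup>2 / w y))" by simp
    also have "complex_of_real (LINT y|\<sigma>. (cmod (?k y))\<^sup>2 / w y) = l2_proj S f x"
      unfolding l2_proj_kernel[OF fC] fk by (rule integral_complex_of_real[symmetric])
    finally show ?thesis
      using integrable_norm[OF integrable_CS[OF basis_kernel_CS, of x]] by (simp add: prob_space)
  qed
  ultimately show thesis using fC that by blast
qed

text \<open>The integral is the norm of the functional \<open>f \<mapsto> l2_proj S f x\<close>. If
  \<open>T u = x\<close>, an almost norming \<open>f\<close> for \<open>x\<close> becomes by
  equivariance an almost norming \<open>f \<circ> T\<close> for \<open>u\<close>. Exchanging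
  \<open>u\<close> and \<open>x\<close> gives equality.\<close>

lemma kernel_integral_le:
  assumes eqv: "\<And>f T. f \<in> CS \<Longrightarrow> orthogonal_transformation T \<Longrightarrow> l2_proj S (f \<circ> T) = l2_proj S f \<circ> T"
    and u: "norm u = 1" and x: "norm x = 1"
  shows "(LINT y|\<sigma>. cmod (basis_kernel B x y)) \<le> (LINT y|\<sigma>. cmod (basis_kernel B u y))"
proof (rule field_le_epsilon)
  let ?L = "\<lambda>x. (LINT y|\<sigma>. cmod (basis_kernel B x y))"
  fix e :: real assume "0 < e"
  then obtain f where f: "f \<in> CS" "vnorm C_sphere f \<le> 1" "?L x - e \<le> cmod (l2_proj S f x)"
    by (rule l2_proj_almost_norming)
  obtain T where T: "orthogonal_transformation T" "T u = x"
    using orthogonal_transformation_exists_1[OF u x] by blast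
  have "cmod (l2_proj S f x) = cmod (l2_proj S (f \<circ> T) u)" using eqv[OF f(1) T(1)] T(2) by simp
  also have "\<dots> \<le> vnorm C_sphere (f \<circ> T) * ?L u"
    by (rule l2_proj_cmod_le[OF CS_rotate[OF f(1) T(1)]])
  also have "\<dots> \<le> 1 * ?L u"
    using CS_norm_rotate_le[OF f(1) T(1)] f(2) by (intro mult_right_mono) auto
  finally show "?L x \<le> ?L u + e" using f(3) by simp
qed

lemma op_norm_l2_proj:
  assumes eqv: "\<And>f T. f \<in> CS \<Longrightarrow> orthogonal_transformation T \<Longrightarrow> l2_proj S (f \<circ> T) = l2_proj S f \<circ> T"
    and u: "norm u = 1"
  shows "op_norm C_sphere (restrict_to C_sphere S) (l2_proj S)
    = ereal (LINT y|\<sigma>. cmod (basis_kernel B u y))" (is "_ = ereal ?L")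
  unfolding op_norm_def restrict_to_simps
proof (rule antisym[OF SUP_least])
  fix f :: "'n cfun" assume "f \<in> {f \<in> CS. vnorm C_sphere f \<le> 1}"
  then have f: "f \<in> CS" "vnorm C_sphere f \<le> 1" by auto
  have "vnorm C_sphere (l2_proj S f) \<le> ?L"
  proof (rule C_sphere_norm_le)
    fix x :: "real ^ 'n" assume "x \<in> sphere 0 1"
    then have x: "norm x = 1" by simp
    have "cmod (l2_proj S f x) \<le> 1 * (LINT y|\<sigma>. cmod (basis_kernel B x y))"
      by (rule order_trans[OF l2_proj_cmod_le[OF f(1)]]) (use f(2) in \<open>intro mult_right_mono; simp\<close>)
    with kernel_integral_le[OF eqv u x] show "cmod (l2_proj S f x) \<le> ?L" by simp
  qed
  then show "ereal (vnorm C_sphere (l2_proj S f)) \<le> ereal ?L" by simp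
next
  let ?N = "SUP f\<in>{f \<in> CS. vnorm C_sphere f \<le> 1}. ereal (vnorm C_sphere (l2_proj S f))"
  show "ereal ?L \<le> ?N"
  proof (rule ereal_le_epsilon2)
    fix e :: real assume "0 < e"
    then obtain f where f: "f \<in> CS" "vnorm C_sphere f \<le> 1" "?L - e \<le> cmod (l2_proj S f u)"
      by (rule l2_proj_almost_norming)
    have "l2_proj S f \<in> CS"
      using orthonormal_basis_comb[OF SC ob] SC by (auto simp: l2_proj_eq[OF SC ob f(1)])
    then have "?L - e \<le> vnorm C_sphere (l2_proj S f)" using f(3) CS_cmod_le u by (meson order_trans)
    then have "ereal ?L \<le> ereal (vnorm C_sphere (l2_proj S f)) + ereal e" by simp
    also have "\<dots> \<le> ?N + ereal e" using f by (intro add_right_mono SUP_upper) auto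
    finally show "ereal ?L \<le> ?N + ereal e" .
  qed
qed

end

section \<open>Extending functionals and partitioning the sphere\<close>

text \<open>One predicate for all properties lets a whole family of extensions be chosen at
  once.\<close>

definition linear_extension ::
  "'b cnspace \<Rightarrow> 'a set \<Rightarrow> ('a \<Rightarrow> 'b) \<Rightarrow> ('a \<Rightarrow> complex) \<Rightarrow> real \<Rightarrow> ('b \<Rightarrow> complex) \<Rightarrow> bool" where
  "linear_extension Y S I \<phi> K F \<longleftrightarrow>
    (\<forall>x\<in>pts Y. \<forall>y\<in>pts Y. F (vadd Y x y) = F x + F y) \<and>
    (\<forall>a. \<forall>x\<in>pts Y. F (vscale Y a x) = a * F x) \<and>
    (\<forall>x\<in>pts Y. cmod (F x) \<le> K * vnorm Y x) \<and> (\<forall>x\<in>S. F (I x) = \<phi> x)"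

lemma linear_extensionD:
  assumes "linear_extension Y S I \<phi> K F"
  shows "\<And>x y. x \<in> pts Y \<Longrightarrow> y \<in> pts Y \<Longrightarrow> F (vadd Y x y) = F x + F y"
    "\<And>a x. x \<in> pts Y \<Longrightarrow> F (vscale Y a x) = a * F x"
    "\<And>x. x \<in> pts Y \<Longrightarrow> cmod (F x) \<le> K * vnorm Y x"
    "\<And>x. x \<in> S \<Longrightarrow> F (I x) = \<phi> x"
  using assms by (auto simp: linear_extension_def)

text \<open>An isometry is injective, so \<open>\<phi>\<close> can be carried along its inverse
  \<open>J\<close> to the image of \<open>I\<close>, where it obeys the same bound and Hahn--Banach
  applies.\<close>

lemma extend_functional:
  fixes I :: "'a \<Rightarrow> 'b"
  assumes X: "complex_normed_space X" and Y: "complex_normed_space Y"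
    and I: "isometric_embedding X Y I"
    and \<phi>: "\<And>x y. x \<in> pts X \<Longrightarrow> y \<in> pts X \<Longrightarrow> \<phi> (vadd X x y) = \<phi> x + \<phi> y"
      "\<And>a x. x \<in> pts X \<Longrightarrow> \<phi> (vscale X a x) = a * \<phi> x"
      "\<And>x. x \<in> pts X \<Longrightarrow> cmod (\<phi> x) \<le> K * vnorm X x"
    and K: "0 \<le> K"
  shows "\<exists>F. linear_extension Y (pts X) I \<phi> K F"
proof -
  interpret X: complex_normed_space X by fact
  interpret Y: complex_normed_space Y by fact
  have Iin: "I x \<in> pts Y" and Ia: "y \<in> pts X \<Longrightarrow> I (vadd X x y) = vadd Y (I x) (I y)"
    and Is: "I (vscale X a x) = vscale Y a (I x)" and In: "vnorm Y (I x) = vnorm X x"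
    if "x \<in> pts X" for a x y
    using I that by (auto simp: isometric_embedding_def clinear_map_def)
  have I0: "I (vzero X) = vzero Y"
    using In[OF X.zero_in] Iin[OF X.zero_in] X.norm_eq_zero[OF X.zero_in] Y.norm_eq_zero by simp
  have inj: "x = y" if x: "x \<in> pts X" and y: "y \<in> pts X" and eq: "I x = I y" for x y
  proof -
    let ?m = "vscale X (- 1) y"
    have m: "?m \<in> pts X" using y by (rule X.scale_in)
    have "I (vadd X x ?m) = vdiff Y (I y) (I y)"
      using x y m eq by (simp add: Ia Is vdiff_def)
    then have "vnorm X (vadd X x ?m) = 0"
      using In[OF X.add_in[OF x m]] Y.diff_self[OF Iin[OF y]] Y.norm_eq_zero[OF Y.zero_in] by simp
    then have "vadd X x ?m = vzero X" using X.norm_eq_zero[OF X.add_in[OF x m]] by simp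
    then have "vadd X y (vadd X x ?m) = y" using X.add_zero[OF y] by simp
    moreover have "vadd X y (vadd X x ?m) = x"
      using X.add_neg_cancel[OF x y] X.add_assoc[OF y x m] by simp
    ultimately show ?thesis by simp
  qed
  define J where "J = inv_into (pts X) I"
  have J: "J (I x) = x" if "x \<in> pts X" for x
    unfolding J_def using that inj by (intro inv_into_f_f inj_onI) auto
  show ?thesis
  proof (rule Y.Hahn_Banach_complex[of "I ` pts X" "\<lambda>y. \<phi> (J y)" K])
    show "vzero Y \<in> I ` pts X" using I0 X.zero_in by force
    show "vadd Y x y \<in> I ` pts X" if "x \<in> I ` pts X" "y \<in> I ` pts X" for x y
      using that by (auto simp: Ia[symmetric] X.add_in)
    show "vscale Y a x \<in> I ` pts X" if "x \<in> I ` pts X" for a x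
      using that by (auto simp: Is[symmetric] X.scale_in)
    show "\<phi> (J (vadd Y x y)) = \<phi> (J x) + \<phi> (J y)" if "x \<in> I ` pts X" "y \<in> I ` pts X" for x y
      using that by (auto simp: Ia[symmetric] X.add_in J \<phi>)
    show "\<phi> (J (vscale Y a x)) = a * \<phi> (J x)" if "x \<in> I ` pts X" for a x
      using that by (auto simp: Is[symmetric] X.scale_in J \<phi>)
    show "cmod (\<phi> (J x)) \<le> K * vnorm Y x" if "x \<in> I ` pts X" for x
      using that by (auto simp: J In \<phi>)
    show ?thesis if F: "\<And>x y. x \<in> pts Y \<Longrightarrow> y \<in> pts Y \<Longrightarrow> F (vadd Y x y) = F x + F y"
      "\<And>a x. x \<in> pts Y \<Longrightarrow> F (vscale Y a x) = a * F x"
      "\<And>x. x \<in> pts Y \<Longrightarrow> cmod (F x) \<le> K * vnorm Y x"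
      "\<And>x. x \<in> I ` pts X \<Longrightarrow> F x = \<phi> (J x)" for F
      using F J by (intro exI[of _ F]) (auto simp: linear_extension_def)
  qed (use Iin K in auto)
qed

text \<open>Balls around a finite net, each with the earlier balls removed: a point belongs to the
  cell whose index is the least among the balls containing it.\<close>

lemma sphere_partition:
  fixes d :: real
  assumes d: "0 < d"
  shows "\<exists>(m :: nat) (h :: nat \<Rightarrow> real ^ 'n::finite) A.
    (\<forall>j<m. norm (h j) = 1) \<and> (\<forall>j. A j \<in> sets \<sigma>) \<and> (\<forall>j. \<forall>y\<in>A j. dist y (h j) < d) \<and>
    disjoint_family_on A {..<m} \<and> (\<Union>j<m. A j) = sphere 0 1"
proof -
  have "sphere (0 :: real ^ 'n) 1 \<subseteq> (\<Union>t\<in>sphere 0 1. ball t d)"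
    using d by (auto intro: centre_in_ball[THEN iffD2])
  then obtain T where T: "T \<subseteq> sphere 0 1" "finite T" "sphere (0 :: real ^ 'n) 1 \<subseteq> (\<Union>t\<in>T. ball t d)"
    by (rule compactE_image[rotated 2]) auto
  obtain h where h: "bij_betw h {0..<card T} T" using ex_bij_betw_nat_finite[OF T(2)] by blast
  define A where "A j = sphere 0 1 \<inter> (ball (h j) d - (\<Union>i<j. ball (h i) d))" for j
  show ?thesis
  proof (intro exI[of _ "card T"] exI[of _ h] exI[of _ A] conjI allI ballI impI)
    show "norm (h j) = 1" if "j < card T" for j
    proof -
      have "h j \<in> T" using bij_betwE[OF h] that by simp
      then show ?thesis using T(1) by auto
    qed
    show "A j \<in> sets \<sigma>" for j
      unfolding A_def sets_sphere_measure sets_restrict_space by (intro imageI) auto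
    show "dist y (h j) < d" if "y \<in> A j" for j y
      using that by (simp add: A_def dist_commute)
    show "disjoint_family_on A {..<card T}"
    proof -
      have "A i \<inter> A j = {}" if "i < j" for i j using that by (auto simp: A_def)
      then show ?thesis
        unfolding disjoint_family_on_def by (metis Int_commute linorder_neqE_nat)
    qed
    show "(\<Union>j<card T. A j) = sphere 0 1"
    proof (intro equalityI subsetI)
      fix y assume y: "y \<in> sphere (0 :: real ^ 'n) 1"
      then obtain t where t: "t \<in> T" "y \<in> ball t d" using T(3) by blast
      then obtain i where i: "i < card T" "y \<in> ball (h i) d"
        using h by (metis atLeastLessThan_iff bij_betw_imp_surj_on imageE)
      define j where "j = (LEAST i. y \<in> ball (h i) d)"
      have "y \<in> ball (h j) d" "j \<le> i" unfolding j_def using i(2) by (auto intro: LeastI Least_le)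
      moreover have "y \<notin> ball (h k) d" if "k < j" for k using that unfolding j_def by (rule not_less_Least)
      ultimately show "y \<in> (\<Union>j<card T. A j)" using y i(1) by (auto simp: A_def intro!: bexI[of _ j])
    qed (auto simp: A_def)
  qed
qed

lemma uniformly_close_finite:
  fixes B :: "'n::finite cfun set"
  assumes "finite B" "B \<subseteq> CS" "0 < \<eta>"
  shows "\<exists>d>0. \<forall>b\<in>B. \<forall>x y. norm x = 1 \<longrightarrow> norm y = 1 \<longrightarrow> dist y x < d \<longrightarrow> cmod (b y - b x) \<le> \<eta>"
  using assms(1,2)
proof (induction B)
  case empty
  show ?case by (auto intro: exI[of _ 1])
next
  case (insert b B)
  then obtain d1 where d1: "d1 > 0" "\<And>b x y. b \<in> B \<Longrightarrow> norm x = 1 \<Longrightarrow> norm y = 1 \<Longrightarrow> dist y x < d1 \<Longrightarrow> cmod (b y - b x) \<le> \<eta>"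
    by auto
  have "uniformly_continuous_on (sphere 0 1) b"
    using insert.prems by (intro compact_uniformly_continuous CS_continuous) auto
  then obtain d2 where "0 < d2" "\<And>x y. norm x = 1 \<Longrightarrow> norm y = 1 \<Longrightarrow> dist y x < d2 \<Longrightarrow> dist (b y) (b x) < \<eta>"
    unfolding uniformly_continuous_on_def using assms(3) by (metis mem_sphere_0)
  then show ?case
    using d1 by (intro exI[of _ "min d1 d2"]) (fastforce simp: dist_norm intro: less_imp_le)
qed

section \<open>The projection constant\<close>

lemma restrict_to_subspace_normed_space:
  assumes X: "complex_normed_space X"
    and S: "S \<subseteq> pts X" "vzero X \<in> S" "\<And>x y. x \<in> S \<Longrightarrow> y \<in> S \<Longrightarrow> vadd X x y \<in> S"
      "\<And>a x. x \<in> S \<Longrightarrow> vscale X a x \<in> S"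
  shows "complex_normed_space (restrict_to X S)"
proof -
  interpret complex_normed_space X by fact
  have "vdiff (restrict_to X S) = vdiff X" by (simp add: vdiff_def fun_eq_iff)
  moreover have "x \<in> S \<Longrightarrow> x \<in> pts X" for x using S(1) by auto
  ultimately show ?thesis
    by unfold_locales
      (auto simp: S add_assoc zero_add diff_self scale_add add_scale scale_scale
        scale_one norm_nonneg norm_eq_zero norm_triangle norm_scale intro: add_commute)
qed

lemma isometric_embeddingD:
  assumes "isometric_embedding X Y I"
  shows "\<And>x. x \<in> pts X \<Longrightarrow> I x \<in> pts Y"
    "\<And>x y. x \<in> pts X \<Longrightarrow> y \<in> pts X \<Longrightarrow> I (vadd X x y) = vadd Y (I x) (I y)"
    "\<And>a x. x \<in> pts X \<Longrightarrow> I (vscale X a x) = vscale Y a (I x)"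
    "\<And>x. x \<in> pts X \<Longrightarrow> vnorm Y (I x) = vnorm X x"
  using assms by (auto simp: isometric_embedding_def clinear_map_def)

text \<open>The weights are integrals of the conjugate kernel over cells, so the triangle inequality
  keeps their total modulus below the integral of the modulus: discretizing costs nothing in norm.
  The error comes from replacing \<open>f\<close> on each cell by a value within
  \<open>\<eta>\<close>.\<close>

lemma sphere_kernel_quadrature:
  fixes k :: "real ^ 'n::finite \<Rightarrow> complex" and A :: "nat \<Rightarrow> (real ^ 'n) set"
  assumes k: "k \<in> CS" and A: "\<And>j. A j \<in> sets \<sigma>"
    and disj: "disjoint_family_on A {..<m}" and cover: "(\<Union>j<m. A j) = sphere 0 1"
  defines "\<kappa> \<equiv> \<lambda>j. LINT t|\<sigma>. indicator (A j) t * cnj (k t)"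
  shows "(\<Sum>j<m. cmod (\<kappa> j)) \<le> (LINT t|\<sigma>. cmod (k t))"
    and "\<lbrakk>f \<in> CS; \<And>j t. j < m \<Longrightarrow> t \<in> A j \<Longrightarrow> cmod (f t - v j) \<le> \<eta>\<rbrakk> \<Longrightarrow>
      cmod ((LINT t|\<sigma>. f t * cnj (k t)) - (\<Sum>j<m. v j * \<kappa> j)) \<le> \<eta> * (LINT t|\<sigma>. cmod (k t))"
proof -
  \<comment> \<open>Exactly one cell contains \<open>t\<close>, so a sum over cells collapses to one
    term.\<close>
  have ind: "(\<Sum>j<m. g j * indicator (A j) t) = g i"
    if "i < m" "t \<in> A i" for g :: "nat \<Rightarrow> 'b::{comm_semiring_1}" and t i
  proof -
    have "indicator (A j) t = (if j = i then 1 else 0 :: 'b)" if "j < m" for j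
      using disj \<open>i < m\<close> \<open>t \<in> A i\<close> that by (auto simp: disjoint_family_on_def indicator_def)
    then have "(\<Sum>j<m. g j * indicator (A j) t) = (\<Sum>j<m. if j = i then g i else 0)"
      by (intro sum.cong) auto
    then show ?thesis using \<open>i < m\<close> by simp
  qed
  have ex: "\<exists>i<m. t \<in> A i" if "norm t = 1" for t
    using cover that by (metis UN_E lessThan_iff mem_sphere_0)
  have kA: "integrable \<sigma> (\<lambda>t. indicator (A j) t * cnj (k t))" for j
    using integrable_CS[OF k] by (intro integrable_indicator_mult A) simp
  have kAn: "integrable \<sigma> (\<lambda>t. cmod (k t) * indicator (A j) t)" for j
    using integrable_real_mult_indicator[OF A[of j] integrable_norm[OF integrable_CS[OF k]]] .
  have "cmod (\<kappa> j) \<le> (LINT t|\<sigma>. cmod (k t) * indicator (A j) t)" for j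
  proof -
    have "cmod (\<kappa> j) \<le> (LINT t|\<sigma>. cmod (indicator (A j) t * cnj (k t)))"
      unfolding \<kappa>_def by (rule integral_norm_bound)
    also have "(\<lambda>t. cmod (indicator (A j) t * cnj (k t))) = (\<lambda>t. cmod (k t) * indicator (A j) t)"
      by (auto simp: indicator_def)
    finally show ?thesis .
  qed
  then have "(\<Sum>j<m. cmod (\<kappa> j)) \<le> (\<Sum>j<m. (LINT t|\<sigma>. cmod (k t) * indicator (A j) t))"
    by (intro sum_mono)
  also have "\<dots> = (LINT t|\<sigma>. (\<Sum>j<m. cmod (k t) * indicator (A j) t))"
    using kAn by (rule Bochner_Integration.integral_sum[symmetric])
  also have "\<dots> = (LINT t|\<sigma>. cmod (k t))"
  proof (rule Bochner_Integration.integral_cong[OF refl])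
    fix t assume "t \<in> space (\<sigma> :: (real ^ 'n) measure)"
    then obtain i where "i < m" "t \<in> A i" using ex by (auto simp: space_sphere_measure)
    then show "(\<Sum>j<m. cmod (k t) * indicator (A j) t) = cmod (k t)" by (rule ind)
  qed
  finally show "(\<Sum>j<m. cmod (\<kappa> j)) \<le> (LINT t|\<sigma>. cmod (k t))" .
  assume f: "f \<in> CS" and close: "\<And>j t. j < m \<Longrightarrow> t \<in> A j \<Longrightarrow> cmod (f t - v j) \<le> \<eta>"
  let ?s = "\<lambda>t. \<Sum>j<m. v j * (indicator (A j) t * cnj (k t))"
  have s: "integrable \<sigma> ?s" "(LINT t|\<sigma>. ?s t) = (\<Sum>j<m. v j * \<kappa> j)"
    using kA by (simp_all add: integral_sum \<kappa>_def)
  have fk: "integrable \<sigma> (\<lambda>t. f t * cnj (k t))" by (rule integrable_inner_CS[OF f k])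
  have "cmod ((LINT t|\<sigma>. f t * cnj (k t)) - (\<Sum>j<m. v j * \<kappa> j)) = cmod (LINT t|\<sigma>. f t * cnj (k t) - ?s t)"
    using s fk by simp
  also have "\<dots> \<le> (LINT t|\<sigma>. cmod (f t * cnj (k t) - ?s t))" by (rule integral_norm_bound)
  also have "\<dots> \<le> (LINT t|\<sigma>. \<eta> * cmod (k t))"
  proof (rule integral_mono)
    show "integrable \<sigma> (\<lambda>t. cmod (f t * cnj (k t) - ?s t))" using s(1) fk by (intro integrable_norm) simp
    show "integrable \<sigma> (\<lambda>t. \<eta> * cmod (k t))" using integrable_norm[OF integrable_CS[OF k]] by simp
    fix t assume "t \<in> space (\<sigma> :: (real ^ 'n) measure)"
    then obtain i where i: "i < m" "t \<in> A i" using ex by (auto simp: space_sphere_measure)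
    have "?s t = (\<Sum>j<m. (v j * cnj (k t)) * indicator (A j) t)" by (simp add: mult_ac)
    also have "\<dots> = v i * cnj (k t)" by (rule ind[OF i])
    finally have "f t * cnj (k t) - ?s t = (f t - v i) * cnj (k t)" by (simp add: left_diff_distrib)
    then show "cmod (f t * cnj (k t) - ?s t) \<le> \<eta> * cmod (k t)"
      using close[OF i] by (simp add: norm_mult mult_right_mono)
  qed
  finally show "cmod ((LINT t|\<sigma>. f t * cnj (k t)) - (\<Sum>j<m. v j * \<kappa> j)) \<le> \<eta> * (LINT t|\<sigma>. cmod (k t))"
    by simp
qed

text \<open>
  Values at finitely many points, extended by Hahn--Banach, give an operator \<open>W\<close> on \<open>Y\<close> that
  factors through a quadrature of the kernel and is close to the identity on \<open>S\<close>.  The error is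
  removed by composing \<open>id - W\<close> with some bounded projection whose norm does not depend on the
  mesh of the quadrature.
\<close>

lemma ex_almost_kernel_projection:
  fixes S B :: "'n::finite cfun set" and Y :: "'y cnspace"
  assumes SC: "S \<subseteq> CS" and ob: "orthonormal_basis S B"
    and Y: "complex_normed_space Y" and I: "isometric_embedding (restrict_to C_sphere S) Y I"
    and \<Lambda>: "\<And>x. norm x = 1 \<Longrightarrow> (LINT y|\<sigma>. cmod (basis_kernel B x y)) \<le> \<Lambda>"
    and e: "0 < e"
  shows "\<exists>P. projection_onto Y (I ` S) P \<and> (\<forall>y\<in>pts Y. vnorm Y (P y) \<le> (\<Lambda> + e) * vnorm Y y)"
proof -
  interpret Y: complex_normed_space Y by fact
  note fin = orthonormal_basis_finite[OF SC ob]
  have BC: "b \<in> CS" if "b \<in> B" for b using orthonormal_basis_CS[OF SC ob that] .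
  have subS: "cfun.subspace S" using ob by (auto simp: orthonormal_basis_def)
  have X: "complex_normed_space (restrict_to C_sphere S)"
  proof (rule restrict_to_subspace_normed_space)
    show "complex_normed_space (C_sphere :: 'n cfun cnspace)"
      by (rule complex_banach_space.axioms(1)[OF C_sphere_complex_banach_space])
    show "vzero C_sphere \<in> S"
      using cfun.subspace_0[OF subS] by (simp add: C_sphere_def zero_fun_def)
    show "vadd C_sphere f g \<in> S" if "f \<in> S" "g \<in> S" for f g
      using cfun.subspace_add[OF subS that] by (simp add: C_sphere_simps plus_fun_def)
    show "vscale C_sphere a f \<in> S" if "f \<in> S" for a f
      using cfun.subspace_scale[OF subS that] by (simp add: C_sphere_simps)
  qed (fact SC)
  note ID = isometric_embeddingD[OF I, unfolded restrict_to_simps C_sphere_simps]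
  define c where "c = (\<Sum>b\<in>B. vnorm C_sphere b)"
  have c: "0 \<le> c" unfolding c_def by (intro sum_nonneg CS_norm_nonneg BC)
  have "0 \<le> \<Lambda>"
  proof -
    obtain u :: "real ^ 'n" where "norm u = 1" using vector_choose_size[of 1, where 'a = "real ^ 'n"] by auto
    have "0 \<le> (LINT y|\<sigma>. cmod (basis_kernel B u y))" by simp
    also have "\<dots> \<le> \<Lambda>" by (rule \<Lambda>[OF \<open>norm u = 1\<close>])
    finally show ?thesis .
  qed
  \<comment> \<open>The correction term below has norm at most
    \<open>c * (\<eta> * \<Lambda>)\<close> times that of \<open>y\<close>; this choice keeps the
    factor below \<open>e\<close>, the \<open>+ 1\<close> preventing a zero denominator.\<close>
  define \<eta> where "\<eta> = e / (c * \<Lambda> + 1)"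
  have \<eta>: "0 < \<eta>" "c * (\<eta> * \<Lambda>) \<le> e"
  proof -
    have "0 < c * \<Lambda> + 1" using c \<open>0 \<le> \<Lambda>\<close> by (simp add: add_nonneg_pos)
    then show "0 < \<eta>" "c * (\<eta> * \<Lambda>) \<le> e" using e by (simp_all add: \<eta>_def field_simps)
  qed
  have "B \<subseteq> CS" using BC by auto
  from uniformly_close_finite[OF fin this \<eta>(1)]
  obtain d where d: "0 < d" "\<And>b x y. b \<in> B \<Longrightarrow> norm x = 1 \<Longrightarrow> norm y = 1 \<Longrightarrow> dist y x < d \<Longrightarrow> cmod (b y - b x) \<le> \<eta>"
    by blast
  obtain m :: nat and h and A :: "nat \<Rightarrow> (real ^ 'n) set" where hA: "\<forall>j<m. norm (h j) = 1"
      "\<forall>j. A j \<in> sets \<sigma>" "\<forall>j. \<forall>y\<in>A j. dist y (h j) < d" "disjoint_family_on A {..<m}" "(\<Union>j<m. A j) = sphere 0 1"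
    using sphere_partition[OF d(1)] by (elim exE conjE)
  note h = hA(1)[rule_format] and A = hA(2,3)[rule_format] hA(4,5)
  have A1: "norm t = 1" if "j < m" "t \<in> A j" for j t
    using A(4) that by (metis UN_I lessThan_iff mem_sphere_0)
  define \<kappa> where "\<kappa> j x = (LINT t|\<sigma>. indicator (A j) t * cnj (basis_kernel B x t))" for j x
  \<comment> \<open>Conjugated, the kernel is \<open>\<Sum> b x * cnj (b t)\<close>, so integrating
    in \<open>t\<close> leaves a combination of the basis in \<open>x\<close>.\<close>
  have \<kappa>S: "\<kappa> j \<in> S" for j
  proof -
    have "integrable \<sigma> (\<lambda>t. indicator (A j) t * cnj (b t))" if "b \<in> B" for b
      using integrable_CS[OF BC[OF that]] by (intro integrable_indicator_mult A) simp
    then have "\<kappa> j = (\<lambda>x. \<Sum>b\<in>B. (LINT t|\<sigma>. indicator (A j) t * cnj (b t)) * b x)"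
      by (simp add: fun_eq_iff \<kappa>_def basis_kernel_def sum_distrib_left mult.left_commute[of "indicator _ _"] mult.commute)
    then show ?thesis using orthonormal_basis_comb[OF SC ob] by simp
  qed
  have \<kappa>_sum: "(\<Sum>j<m. cmod (\<kappa> j x)) \<le> \<Lambda>" if "norm x = 1" for x
    using sphere_kernel_quadrature(1)[OF basis_kernel_CS[OF SC ob] A(1) A(3) A(4), of x] \<Lambda>[OF that]
    by (simp add: \<kappa>_def)
  \<comment> \<open>The quadrature of the orthogonal projection, which depends on \<open>f\<close>
    only through its values at the nodes.\<close>
  define V where "V f x = (\<Sum>j<m. f (h j) * \<kappa> j x)" for f x
  have V_close: "cmod (b x - V b x) \<le> \<eta> * \<Lambda>" if b: "b \<in> B" and x: "norm x = 1" for b x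
  proof -
    have "b x = l2_proj S b x"
      using orthonormal_basis_sub[OF SC ob] b
      by (subst l2_proj_eq[OF SC ob BC[OF b]]) (auto intro!: orthonormal_expansion[OF SC ob])
    also have "\<dots> = (LINT y|\<sigma>. b y * cnj (basis_kernel B x y))"
      by (rule l2_proj_kernel[OF SC ob BC[OF b]])
    finally have "cmod (b x - V b x) \<le> \<eta> * (LINT y|\<sigma>. cmod (basis_kernel B x y))"
      using sphere_kernel_quadrature(2)[OF basis_kernel_CS[OF SC ob] A(1) A(3) A(4) BC[OF b], of "\<lambda>j. b (h j)" \<eta> x]
        d(2)[OF b h A1] A(2) by (simp add: \<kappa>_def V_def)
    also have "\<dots> \<le> \<eta> * \<Lambda>" using \<Lambda>[OF x] \<eta>(1) by (intro mult_left_mono) auto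
    finally show ?thesis .
  qed
  have "\<exists>F. linear_extension Y (pts (restrict_to C_sphere S)) I (\<lambda>f. f (h j)) 1 F"
    if j: "j < m" for j
  proof (rule extend_functional[OF X Y I])
    show "cmod (f (h j)) \<le> 1 * vnorm (restrict_to C_sphere S) f" if "f \<in> pts (restrict_to C_sphere S)" for f
      using that SC h[OF j] by (auto intro: CS_cmod_le)
  qed (simp_all add: C_sphere_simps)
  then have "\<forall>j\<in>{..<m}. \<exists>F. linear_extension Y S I (\<lambda>f. f (h j)) 1 F" by simp
  from bchoice[OF this] obtain R where "\<And>j. j < m \<Longrightarrow> linear_extension Y S I (\<lambda>f. f (h j)) 1 (R j)"
    by auto
  note R = this[THEN linear_extensionD(1)] this[THEN linear_extensionD(2)]
    this[THEN linear_extensionD(3), unfolded mult_1] this[THEN linear_extensionD(4)]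
  \<comment> \<open>The extended coefficients define a bounded projection of \<open>Y\<close> onto
    the copy of \<open>S\<close>; their bounds are those of the basis and do not involve the
    partition.\<close>
  have "\<exists>F. linear_extension Y (pts (restrict_to C_sphere S)) I (\<lambda>f. l2_inner f b) (vnorm C_sphere b) F"
    if b: "b \<in> B" for b
  proof (rule extend_functional[OF X Y I])
    show "l2_inner (vadd (restrict_to C_sphere S) f g) b = l2_inner f b + l2_inner g b"
      if "f \<in> pts (restrict_to C_sphere S)" "g \<in> pts (restrict_to C_sphere S)" for f g
      using l2_inner_add_left[of f g b] that SC BC[OF b] by (auto simp: C_sphere_simps plus_fun_def)
    show "l2_inner (vscale (restrict_to C_sphere S) a f) b = a * l2_inner f b" for a f
      by (simp add: C_sphere_simps l2_inner_scale_left)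
    show "cmod (l2_inner f b) \<le> vnorm C_sphere b * vnorm (restrict_to C_sphere S) f"
      if "f \<in> pts (restrict_to C_sphere S)" for f
      using norm_l2_inner_le[of f b] that SC BC[OF b] by (auto simp: mult.commute)
  qed (rule CS_norm_nonneg[OF BC[OF b]])
  then have "\<forall>b\<in>B. \<exists>F. linear_extension Y S I (\<lambda>f. l2_inner f b) (vnorm C_sphere b) F" by simp
  from bchoice[OF this] obtain E where "\<And>b. b \<in> B \<Longrightarrow> linear_extension Y S I (\<lambda>f. l2_inner f b) (vnorm C_sphere b) (E b)"
    by auto
  note E = this[THEN linear_extensionD(1)] this[THEN linear_extensionD(2)]
    this[THEN linear_extensionD(3)] this[THEN linear_extensionD(4)]
  \<comment> \<open>With \<open>W\<close> the first sum and \<open>Q y = \<Sum> E b y * b\<close>,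
    this is \<open>W + (id - W) Q\<close>, written inside \<open>S\<close> before \<open>I\<close>
    is applied. On the image of \<open>f\<close> the two sums are \<open>V f\<close> and
    \<open>f - V f\<close>, so \<open>S\<close> is reproduced exactly.\<close>
  define s where "s y x = (\<Sum>j<m. R j y * \<kappa> j x) + (\<Sum>b\<in>B. E b y * (b x - V b x))" for y x
  have combS: "(\<lambda>x. \<Sum>i\<in>N. u i * g i x) \<in> S" if "\<And>i. i \<in> N \<Longrightarrow> g i \<in> S" for N :: "'i set" and u g
  proof -
    have "(\<Sum>i\<in>N. (\<lambda>x. u i * g i x)) \<in> S"
      using that by (intro cfun.subspace_sum[OF subS] cfun.subspace_scale[OF subS])
    also have "(\<Sum>i\<in>N. (\<lambda>x. u i * g i x)) = (\<lambda>x. \<Sum>i\<in>N. u i * g i x)"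
      by (auto simp: sum_fun_apply)
    finally show ?thesis .
  qed
  have sS: "s y \<in> S" for y
  proof -
    have "V b \<in> S" for b unfolding V_def by (rule combS[OF \<kappa>S])
    then have "(\<lambda>x. b x - V b x) \<in> S" if "b \<in> B" for b
      using cfun.subspace_diff[OF subS, of b "V b"] that orthonormal_basis_sub[OF SC ob]
      by (auto simp: fun_diff_def)
    then have "(\<lambda>x. \<Sum>j<m. R j y * \<kappa> j x) + (\<lambda>x. \<Sum>b\<in>B. E b y * (b x - V b x)) \<in> S"
      by (intro cfun.subspace_add[OF subS] combS \<kappa>S)
    then show ?thesis by (simp add: s_def[abs_def] plus_fun_def)
  qed
  have s_add: "s (vadd Y y z) = (\<lambda>x. s y x + s z x)" if "y \<in> pts Y" "z \<in> pts Y" for y z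
    using that by (simp add: s_def fun_eq_iff R(1) E(1) distrib_right sum.distrib)
  have s_scale: "s (vscale Y a y) = (\<lambda>x. a * s y x)" if "y \<in> pts Y" for a y
    using that by (simp add: s_def fun_eq_iff R(2) E(2) distrib_left sum_distrib_left mult.assoc)
  have s_id: "s (I f) = f" if f: "f \<in> S" for f
  proof
    fix x
    have ex: "f x = (\<Sum>b\<in>B. l2_inner f b * b x)" for x by (rule orthonormal_expansion[OF SC ob f])
    have "(\<Sum>b\<in>B. l2_inner f b * V b x) = (\<Sum>j<m. (\<Sum>b\<in>B. l2_inner f b * b (h j)) * \<kappa> j x)"
      unfolding V_def sum_distrib_left sum_distrib_right by (subst sum.swap) (simp add: mult.assoc)
    also have "\<dots> = (\<Sum>j<m. f (h j) * \<kappa> j x)" by (simp add: ex[symmetric])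
    finally show "s (I f) x = f x"
      using f by (simp add: s_def R(4) E(4) right_diff_distrib sum_subtractf ex[symmetric])
  qed
  have s_le: "vnorm C_sphere (s y) \<le> (\<Lambda> + e) * vnorm Y y" if y: "y \<in> pts Y" for y
  proof (rule C_sphere_norm_le)
    fix x :: "real ^ 'n" assume "x \<in> sphere 0 1"
    then have x: "norm x = 1" by simp
    have n: "0 \<le> vnorm Y y" by (rule Y.norm_nonneg[OF y])
    have "cmod (\<Sum>j<m. R j y * \<kappa> j x) \<le> (\<Sum>j<m. vnorm Y y * cmod (\<kappa> j x))"
      using R(3) y by (intro sum_norm_le) (auto simp: norm_mult intro!: mult_right_mono)
    also have "\<dots> \<le> vnorm Y y * \<Lambda>"
      unfolding sum_distrib_left[symmetric] using \<kappa>_sum[OF x] n by (intro mult_left_mono) auto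
    finally have 1: "cmod (\<Sum>j<m. R j y * \<kappa> j x) \<le> vnorm Y y * \<Lambda>" .
    have "cmod (\<Sum>b\<in>B. E b y * (b x - V b x)) \<le> (\<Sum>b\<in>B. (vnorm C_sphere b * vnorm Y y) * (\<eta> * \<Lambda>))"
      using E(3) y V_close[OF _ x] n
      by (intro sum_norm_le) (auto simp: norm_mult intro!: mult_mono mult_nonneg_nonneg CS_norm_nonneg BC)
    also have "\<dots> = vnorm Y y * (c * (\<eta> * \<Lambda>))"
      by (simp add: c_def sum_distrib_left sum_distrib_right mult_ac)
    also have "\<dots> \<le> vnorm Y y * e" using \<eta>(2) n by (rule mult_left_mono)
    finally have 2: "cmod (\<Sum>b\<in>B. E b y * (b x - V b x)) \<le> vnorm Y y * e" .
    show "cmod (s y x) \<le> (\<Lambda> + e) * vnorm Y y"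
      unfolding s_def using norm_triangle_le[OF add_mono[OF 1 2]] by (simp add: algebra_simps)
  qed
  have le: "vnorm Y (I (s y)) \<le> (\<Lambda> + e) * vnorm Y y" if "y \<in> pts Y" for y
    using s_le[OF that] ID(4)[OF sS] by simp
  have "projection_onto Y (I ` S) (\<lambda>y. I (s y))"
    unfolding projection_onto_def bounded_clinear_map_def clinear_map_def restrict_to_simps
    using le by (auto simp: sS s_add s_scale s_id ID(2,3))
  with le show ?thesis by blast
qed

text \<open>The superspaces compared live on a sum type, so the space of continuous functions has to
  be moved into its right summand to take part.\<close>

definition copy_space :: "'a cnspace \<Rightarrow> ('b + 'a) cnspace" where
  "copy_space X = \<lparr>pts = Inr ` pts X, vadd = (\<lambda>x y. Inr (vadd X (projr x) (projr y))),
     vzero = Inr (vzero X), vscale = (\<lambda>a x. Inr (vscale X a (projr x))),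
     vnorm = (\<lambda>x. vnorm X (projr x))\<rparr>"

lemma copy_space_simps [simp]:
  "pts (copy_space X) = Inr ` pts X" "vadd (copy_space X) (Inr x) (Inr y) = Inr (vadd X x y)"
  "vzero (copy_space X) = Inr (vzero X)" "vscale (copy_space X) a (Inr x) = Inr (vscale X a x)"
  "vnorm (copy_space X) (Inr x) = vnorm X x" "vdiff (copy_space X) (Inr x) (Inr y) = Inr (vdiff X x y)"
  by (simp_all add: copy_space_def vdiff_def)

lemma copy_space_banach:
  assumes "complex_banach_space X"
  shows "complex_banach_space (copy_space X)"
proof -
  interpret complex_banach_space X by fact
  show ?thesis
  proof
    fix u :: "nat \<Rightarrow> 'b + 'a"
    assume u: "\<And>i. u i \<in> pts (copy_space X)"
      and c: "\<And>e. e > 0 \<Longrightarrow> \<exists>N. \<forall>i\<ge>N. \<forall>j\<ge>N. vnorm (copy_space X) (vdiff (copy_space X) (u i) (u j)) < e"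
    define w where "w i = projr (u i)" for i
    have w: "u i = Inr (w i)" "w i \<in> pts X" for i using u[of i] by (auto simp: w_def)
    have "\<exists>l\<in>pts X. (\<lambda>i. vnorm X (vdiff X (w i) l)) \<longlonglongrightarrow> 0"
      using c w(2) by (intro complete) (simp_all add: w(1))
    then show "\<exists>l\<in>pts (copy_space X). (\<lambda>i. vnorm (copy_space X) (vdiff (copy_space X) (u i) l)) \<longlonglongrightarrow> 0"
      by (auto simp: w(1))
  qed (auto simp: zero_in add_in scale_in add_assoc zero_add diff_self scale_add add_scale scale_scale
      scale_one norm_nonneg norm_eq_zero norm_triangle norm_scale intro: add_commute)
qed

lemma first_unit_vector_norm: "norm (first_unit_vector :: real ^ 'n::{finite, wellorder}) = 1"
  by (simp add: first_unit_vector_def)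

section \<open>From norm bounds on projections to projection constants\<close>

lemma rel_proj_const_le:
  assumes Y: "complex_normed_space Y" and K: "0 \<le> K"
    and P: "\<And>e. 0 < e \<Longrightarrow> \<exists>P. projection_onto Y X P \<and> (\<forall>y\<in>pts Y. vnorm Y (P y) \<le> (K + e) * vnorm Y y)"
  shows "rel_proj_const X Y \<le> ereal K"
proof (rule ereal_le_epsilon2)
  fix e :: real assume e: "0 < e"
  from P[OF e] obtain P where P: "projection_onto Y X P" "\<And>y. y \<in> pts Y \<Longrightarrow> vnorm Y (P y) \<le> (K + e) * vnorm Y y"
    by blast
  have "rel_proj_const X Y \<le> op_norm Y (restrict_to Y X) P"
    unfolding rel_proj_const_def using P(1) by (intro INF_lower) simp
  also have "\<dots> \<le> ereal (K + e)"
    unfolding op_norm_def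
  proof (rule SUP_least)
    fix y assume "y \<in> {y \<in> pts Y. vnorm Y y \<le> 1}"
    then have "vnorm Y (P y) \<le> (K + e) * 1"
      using P(2)[of y] K e by (auto intro: order_trans mult_left_mono)
    then show "ereal (vnorm (restrict_to Y X) (P y)) \<le> ereal (K + e)" by simp
  qed
  finally show "rel_proj_const X Y \<le> ereal K + ereal e" by simp
qed

lemma projection_bound_of_op_norm:
  assumes Y: "complex_normed_space Y" and P: "projection_onto Y X P"
    and r: "\<And>y. y \<in> pts Y \<Longrightarrow> vnorm Y y \<le> 1 \<Longrightarrow> vnorm Y (P y) \<le> r" and X: "X \<subseteq> pts Y"
    and y: "y \<in> pts Y"
  shows "vnorm Y (P y) \<le> r * vnorm Y y"
proof -
  interpret complex_normed_space Y by fact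
  have Py: "P y \<in> pts Y" using projection_ontoD(1)[OF P y] X by auto
  show ?thesis
  proof (cases "vnorm Y y = 0")
    case True
    obtain K where "\<forall>x\<in>pts Y. vnorm Y (P x) \<le> K * vnorm Y x" using projection_ontoD(5)[OF P] by blast
    then have "vnorm Y (P y) \<le> K * vnorm Y y" using y by blast
    then show ?thesis using True by simp
  next
    case False
    then have n: "0 < vnorm Y y" using norm_nonneg[OF y] by simp
    let ?a = "complex_of_real (1 / vnorm Y y)"
    have "vnorm Y (vscale Y ?a y) \<le> 1" using n y by (simp add: norm_scale norm_divide)
    then have "vnorm Y (P (vscale Y ?a y)) \<le> r" using y by (intro r scale_in)
    then have "cmod ?a * vnorm Y (P y) \<le> r"
      using y Py by (simp only: projection_ontoD(4)[OF P] norm_scale)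
    then show ?thesis using n by (simp add: norm_divide field_simps)
  qed
qed

text \<open>Conjugating \<open>P\<close> with \<open>Inr\<close> gives a projection
  \<open>P'\<close> of the space of continuous functions onto \<open>S\<close> with the same norm,
  to which averaging applies.\<close>

lemma copy_space_projection_norm:
  fixes S :: "'n::{finite, wellorder} cfun set" and P :: "'y + 'n cfun \<Rightarrow> 'y + 'n cfun"
  assumes S: "finite_dim_subspace S" and inv: "orthogonal_invariant S"
    and uniq: "\<And>Q. equivariant_projection S Q \<Longrightarrow> (\<forall>f\<in>CS. Q f = R f)"
    and P: "projection_onto (copy_space C_sphere) (Inr ` S) P"
  shows "op_norm C_sphere (restrict_to C_sphere S) R
    \<le> op_norm (copy_space C_sphere) (restrict_to (copy_space C_sphere) (Inr ` S)) P" (is "_ \<le> ?N")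
proof -
  have SC: "S \<subseteq> CS" using S by (simp add: finite_dim_subspace_def)
  define P' where "P' f = projr (P (Inr f))" for f
  note PD = projection_ontoD[OF P]
  have P': "P (Inr f) = Inr (P' f)" "P' f \<in> S" if "f \<in> CS" for f
    using PD(1)[of "Inr f"] that by (auto simp: P'_def)
  have P'C: "P' f \<in> CS" if "f \<in> CS" for f using P'(2)[OF that] SC by auto
  have cns: "complex_normed_space (C_sphere :: 'n cfun cnspace)"
    by (rule complex_banach_space.axioms(1)[OF C_sphere_complex_banach_space])
  interpret C: complex_normed_space "C_sphere :: 'n cfun cnspace" by (rule cns)
  obtain K where K: "\<And>f. f \<in> CS \<Longrightarrow> vnorm C_sphere (P' f) \<le> K * vnorm C_sphere f"
    using PD(5) P' by auto
  have proj: "projection_onto C_sphere S P'"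
    unfolding projection_onto_def bounded_clinear_map_def clinear_map_def restrict_to_simps
  proof (intro conjI ballI allI)
    show "P' f \<in> S" if "f \<in> CS" for f using P'(2)[OF that] .
    show "P' (vadd C_sphere f g) = vadd C_sphere (P' f) (P' g)" if "f \<in> CS" "g \<in> CS" for f g
      using PD(3)[of "Inr f" "Inr g"] that P'(1) C.add_in[OF that] by simp
    show "P' (vscale C_sphere a f) = vscale C_sphere a (P' f)" if "f \<in> CS" for a f
      using PD(4)[of "Inr f" a] that P'(1) C.scale_in[OF that] by simp
    show "\<exists>K. \<forall>f\<in>CS. vnorm C_sphere (P' f) \<le> K * vnorm C_sphere f" using K by blast
    show "P' f = f" if "f \<in> S" for f
      using PD(2)[of "Inr f"] that by (simp add: P'_def)
  qed
  have le: "ereal (vnorm C_sphere (P' f)) \<le> ?N" if "f \<in> CS" "vnorm C_sphere f \<le> 1" for f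
  proof -
    have "ereal (vnorm C_sphere (P' f)) = ereal (vnorm (restrict_to (copy_space C_sphere) (Inr ` S)) (P (Inr f)))"
      using that P' by simp
    also have "\<dots> \<le> ?N"
      unfolding op_norm_def using that by (intro SUP_upper) auto
    finally show ?thesis .
  qed
  show ?thesis
  \<comment> \<open>The value infinity is trivial, and minus infinity is excluded by the zero
    function in the unit ball. For a finite value the same function shows \<open>0 \<le> r\<close>,
    as the averaging bound demands.\<close>
  proof (cases ?N)
    case (real r)
    have r: "vnorm C_sphere (P' f) \<le> r" if "f \<in> CS" "vnorm C_sphere f \<le> 1" for f
      using le[OF that] real by simp
    have r0: "0 \<le> r"
      using r[OF C.zero_in] C.norm_eq_zero[OF C.zero_in] CS_norm_nonneg[OF P'C[OF C.zero_in]] by simp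
    have bound: "\<forall>f\<in>CS. vnorm C_sphere (P' f) \<le> r * vnorm C_sphere f"
      using projection_bound_of_op_norm[OF cns proj r SC] by blast
    have "vnorm C_sphere (R f) \<le> r" if f: "f \<in> CS" "vnorm C_sphere f \<le> 1" for f
    proof -
      have "vnorm C_sphere (R f) \<le> r * vnorm C_sphere f"
        by (rule unique_equivariant_projection_norm_le[OF S inv uniq proj r0 bound f(1)])
      also have "\<dots> \<le> r" using f(2) r0 mult_left_le by blast
      finally show ?thesis .
    qed
    then show ?thesis unfolding real by (auto simp: op_norm_def intro!: SUP_least)
  next
    case MInf
    then show ?thesis
      using le[OF C.zero_in] C.norm_eq_zero[OF C.zero_in] by simp
  qed simp
qed

theorem theorem3p1:
  fixes S :: "(real ^ 'n::{finite, wellorder} \<Rightarrow> complex) set"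
  assumes "finite_dim_subspace S"
    and "orthogonal_invariant S"
    and "equivariant_projection S (l2_proj S)"
    and "\<And>Q. equivariant_projection S Q \<Longrightarrow> (\<forall>f\<in>pts C_sphere. Q f = l2_proj S f)"
  shows "abs_proj_const TYPE('y + (real ^ 'n::{finite, wellorder} \<Rightarrow> complex)) (restrict_to C_sphere S)
           = op_norm C_sphere (restrict_to C_sphere S) (l2_proj S)
       \<and> op_norm C_sphere (restrict_to C_sphere S) (l2_proj S)
           = ereal (LINT y|sphere_measure. cmod (repr_kernel S first_unit_vector y))"
proof -
  have SC: "S \<subseteq> CS" using assms(1) by (simp add: finite_dim_subspace_def)
  define B where "B = (SOME B. orthonormal_basis S B)"
  have ob: "orthonormal_basis S B"
    unfolding B_def using ex_orthonormal_basis[OF assms(1)] by (rule someI_ex)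
  have eqv: "l2_proj S (f \<circ> T) = l2_proj S f \<circ> T" if "f \<in> CS" "orthogonal_transformation T" for f T
    using assms(3) that by (auto simp: equivariant_projection_def)
  let ?u = "first_unit_vector :: real ^ 'n::{finite, wellorder}"
  let ?L = "LINT y|sphere_measure. cmod (repr_kernel S ?u y)"
  have L: "?L = (LINT y|sphere_measure. cmod (basis_kernel B ?u y))"
    by (simp add: repr_kernel_def basis_kernel_def B_def)
  have op: "op_norm C_sphere (restrict_to C_sphere S) (l2_proj S) = ereal ?L"
    unfolding L by (rule op_norm_l2_proj[OF SC ob eqv first_unit_vector_norm])
  have "abs_proj_const TYPE('y + (real ^ 'n::{finite, wellorder} \<Rightarrow> complex)) (restrict_to C_sphere S) = ereal ?L"
    unfolding abs_proj_const_def restrict_to_simps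
  proof (rule antisym)
    show "Sup {rel_proj_const (I ` S) Y | (Y :: ('y + (real ^ 'n::{finite, wellorder} \<Rightarrow> complex)) cnspace) I.
        complex_banach_space Y \<and> isometric_embedding (restrict_to C_sphere S) Y I} \<le> ereal ?L"
    proof (rule Sup_least, clarify)
      fix Y :: "('y + (real ^ 'n::{finite, wellorder} \<Rightarrow> complex)) cnspace" and I
      assume Y: "complex_banach_space Y" and I: "isometric_embedding (restrict_to C_sphere S) Y I"
      have Yn: "complex_normed_space Y" using Y by (rule complex_banach_space.axioms(1))
      show "rel_proj_const (I ` S) Y \<le> ereal ?L"
      proof (rule rel_proj_const_le[OF Yn])
        show "0 \<le> ?L" by simp
        show "\<exists>P. projection_onto Y (I ` S) P \<and> (\<forall>y\<in>pts Y. vnorm Y (P y) \<le> (?L + e) * vnorm Y y)"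
          if "0 < e" for e
          unfolding L
          \<comment> \<open>The integral at \<open>?u\<close> serves as the uniform bound
            \<open>\<Lambda>\<close>, since the integral at any unit vector is at most that at
            \<open>?u\<close>.\<close>
          by (rule ex_almost_kernel_projection[OF SC ob Yn I kernel_integral_le[OF SC ob eqv first_unit_vector_norm] that])
      qed
    qed
    \<comment> \<open>One superspace is enough for a lower bound on a supremum: \<open>S\<close>
      included in the continuous functions.\<close>
    let ?Y = "copy_space C_sphere :: ('y + (real ^ 'n::{finite, wellorder} \<Rightarrow> complex)) cnspace"
    have "isometric_embedding (restrict_to C_sphere S) ?Y Inr"
      using SC by (auto simp: isometric_embedding_def clinear_map_def)
    then have "rel_proj_const (Inr ` S) ?Y \<le> Sup {rel_proj_const (I ` S) Y |
        (Y :: ('y + (real ^ 'n::{finite, wellorder} \<Rightarrow> complex)) cnspace) I.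
        complex_banach_space Y \<and> isometric_embedding (restrict_to C_sphere S) Y I}"
      using copy_space_banach[OF C_sphere_complex_banach_space] by (intro Sup_upper) blast
    moreover have "ereal ?L \<le> rel_proj_const (Inr ` S) ?Y"
      unfolding rel_proj_const_def op[symmetric]
      using copy_space_projection_norm[OF assms(1,2,4)] by (intro INF_greatest) auto
    ultimately show "ereal ?L \<le> Sup {rel_proj_const (I ` S) Y |
        (Y :: ('y + (real ^ 'n::{finite, wellorder} \<Rightarrow> complex)) cnspace) I.
        complex_banach_space Y \<and> isometric_embedding (restrict_to C_sphere S) Y I}"
      by (rule order_trans[rotated])
  qed
  with op show ?thesis by simp
qed

end
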